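(* Let $R>0$ be fixed and $z\in\mathbb{C}$ with $\Re(z)>0$, $|z|\le R$. Then $$ m_{z}(\alpha)=\ell(z)+O\!\left(e^{-\alpha\log\alpha+O_{R}(\alpha)}\right)\quad(\alpha\to\infty), $$ where $$ \ell(z)=e^{(z-1)\gamma}\prod_{p}\left(1+\frac{z-1}{p}\right)\left(1-\frac{1}{p}\right)^{z-1}. $$ Moreover, $\ell(z)$ given by this product is an analytic function of $z\in\mathbb{C}$, and $\ell(z)\ne0$ if $z\ne1$ and $z\neq 1-p$ for every prime $p$.
   Context: $\gamma$ is Euler's constant; products over $p$ run over all primes; powers of positive reals are $a^{w}=e^{w\log a}$ with the real logarithm. $g(1,z)=\prod_p\left(1+\frac{z}{p-1}\right)\left(1-\frac1p\right)^{z}$ and $\Gamma$ is the Gamma function. For $\Re(z)>0$: $m_z(\alpha)=\frac{g(1,z)}{\Gamma(z)}\left(\alpha^{z-1}+(1-z)\alpha^{z-1}\int_1^\alpha \frac{du}{u^{z}(u-1)^{1-z}}\right)$ for $1\le\alpha\le2$, and $m_z(\alpha)=2^{1-z}m_z(2)\alpha^{z-1}+(1-z)\alpha^{z-1}\int_2^\alpha \frac{m_z(u-1)}{u^{z}}\,du$ for $\alpha>2$. *)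

theory Defs
  imports "HOL-Complex_Analysis.Complex_Analysis" "HOL-Computational_Algebra.Primes"
begin

text \<open>
  An infinite product over the primes is written as an infinite product over all natural
  numbers (in increasing order) whose factors at non-primes are 1. Factors that vanish at
  finitely many primes are allowed by \<^const>\<open>has_prod\<close>, and the product is then 0.
  On positive reals, complex \<^const>\<open>powr\<close> is exp (w * ln a) with the real logarithm.
\<close>

definition g1 :: "complex \<Rightarrow> complex" where
  "g1 z = (\<Prod>p. if prime p
     then (1 + z / (of_nat p - 1)) * complex_of_real (1 - 1 / real p) powr z else 1)"

definition ell_factor :: "complex \<Rightarrow> nat \<Rightarrow> complex" where
  "ell_factor z p = (if prime p
     then (1 + (z - 1) / of_nat p) * complex_of_real (1 - 1 / real p) powr (z - 1) else 1)"

definition ell :: "complex \<Rightarrow> complex" where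
  "ell z = exp ((z - 1) * euler_mascheroni) * (\<Prod>p. ell_factor z p)"

lemma integral_fundef_cong [fundef_cong]:
  "A = B \<Longrightarrow> (\<And>x. x \<in> B \<Longrightarrow> f x = h x) \<Longrightarrow> integral A f = integral B h"
  by (auto intro: Henstock_Kurzweil_Integration.integral_cong)

text \<open>
  The function is only meaningful for \<open>Re z > 0\<close> and \<open>\<alpha> \<ge> 1\<close>; the value 0 for \<open>\<alpha> < 1\<close> is
  a dummy that the recursion never uses. The first integrand is singular at \<open>u = 1\<close>, where
  HOL assigns it the value 0; it is absolutely integrable on \<open>{1..\<alpha>}\<close> when \<open>Re z > 0\<close>.
\<close>

function mfun :: "complex \<Rightarrow> real \<Rightarrow> complex" where
  "mfun z \<alpha> =
    (if \<alpha> < 1 then 0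
     else if \<alpha> \<le> 2 then
       g1 z / Gamma z *
         (complex_of_real \<alpha> powr (z - 1)
          + (1 - z) * complex_of_real \<alpha> powr (z - 1) *
            integral {1..\<alpha>} (\<lambda>u. 1 / (complex_of_real u powr z
                                     * complex_of_real (u - 1) powr (1 - z))))
     else
       2 powr (1 - z) * mfun z 2 * complex_of_real \<alpha> powr (z - 1)
       + (1 - z) * complex_of_real \<alpha> powr (z - 1) *
         integral {2..\<alpha>} (\<lambda>u. mfun z (u - 1) / complex_of_real u powr z))"
  by pat_completeness auto
termination
proof (relation "Wellfounded.measure (\<lambda>(z, \<alpha>). nat \<lceil>\<alpha>\<rceil>)", goal_cases)
  case 1
  show ?case by simp
next
  case (2 z \<alpha>)
  then show ?case by simp linarith
next
  case (3 z \<alpha> u)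
  then have "\<lceil>u\<rceil> \<le> \<lceil>\<alpha>\<rceil>" "\<lceil>\<alpha>\<rceil> > 0"
    by (auto simp: ceiling_mono)
  then show ?case by simp
qed

text \<open>The defining equation, used as a simplification rule, would unfold forever.\<close>

declare mfun.simps [simp del]

end

theory Submission
  imports Defs
begin

text \<open>
  Continued to the interval from 0 to 1 by a multiple of \<open>t powr (z - 1)\<close>, the function \<open>m\<close> satisfies
  \<open>t * m' t = (z - 1) * (m t - m (t - 1))\<close>. Hence the maximum of the modulus of \<open>m'\<close> on
  \<open>[n, n + 1]\<close> is at most \<open>\<bar>z - 1\<bar> / n\<close> times its maximum on \<open>[n - 1, n]\<close>, so that \<open>m\<close> has a limit,
  approached at a rate of the order of \<open>A ^ n / n!\<close>. The limit is read off the Laplace transform of \<open>m\<close>,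
  which solves a linear differential equation of first order. Factor by factor, the product
  in \<open>ell z\<close> is the one defining \<open>g1 z\<close>, and Euler's constant is the limit of \<open>Ein n - ln n\<close>.
\<close>

section \<open>The product over the primes\<close>

text \<open>The error must be uniform over the half-disc \<open>Re z > 0\<close>,
  \<open>norm z \<le> R\<close>, which is not compact: as \<open>Re z\<close> tends to 0 the
  integrand in the first branch of \<open>mfun\<close> stops being integrable at 1. All constants
  therefore have to come from expressions that stay bounded up to that edge. Once this is done on a
  bounded interval, the delay equation sees \<open>z\<close> only through
  \<open>norm (z - 1) \<le> R + 1\<close>. The identification of the limit, by contrast, is carried
  out for each \<open>z\<close> separately, because the rate of approach to some limit is already
  uniform. \<open>Ein\<close> enters as the exponent of an integrating factor: the transformed
  equation reads (s Lap)' = -(z - 1) ((1 - exp(-s)) / s) (s Lap), and \<open>Ein\<close> is the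
  integral of (1 - exp(-s)) / s. For large s it behaves like ln s plus Euler's constant, while the
  integral of exp(-x) x^(z - 1) supplies a \<open>Gamma z\<close> that cancels the one in the
  definition of m. This is how exp((z - 1) gamma) times \<open>g1 z\<close> arises.\<close>

lemma norm_exp_ln_le:
  fixes a :: complex and w :: real
  assumes "norm a \<le> A" "0 \<le> w" "w \<le> 1/2"
  shows "norm (exp (a * of_real (ln (1 - w)))) \<le> 2 powr A"
proof -
  have "ln (1 - w) \<ge> ln (1/2)" using assms by (subst ln_le_cancel_iff) auto
  moreover have "ln (1/2::real) = - ln 2" by (simp add: ln_div)
  moreover have "ln (1 - w) \<le> 0" using assms by simp
  ultimately have l: "\<bar>ln (1 - w)\<bar> \<le> ln 2" by linarith
  have "Re a * ln (1 - w) \<le> \<bar>Re a\<bar> * \<bar>ln (1 - w)\<bar>" by (metis abs_ge_self abs_mult)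
  also have "\<dots> \<le> A * ln 2"
    using l assms(1) abs_Re_le_cmod[of a] by (intro mult_mono) auto
  finally show ?thesis by (simp add: powr_def)
qed

text \<open>With w = 1/p and a = z - 1 the factor is F(w) = (1 + a w) (1 - w)^a. The linear terms
  cancel: F'(w) = -a (1 + a) (w / (1 - w)) (1 - w)^a is O(w), so F(w) - F(0) is O(w^2). For w at
  most 1/2, \<open>2 powr A\<close> bounds (1 - w)^a and the factor 2 bounds 1 / (1 - w).\<close>

lemma norm_ell_factor_minus_1_le:
  assumes "norm (z - 1) \<le> A" "p \<ge> 1"
  shows "norm (ell_factor z p - 1) \<le> 2 * A * (1 + A) * 2 powr A * inverse (real p ^ 2)"
proof (cases "prime p")
  case False
  have "A \<ge> 0" using assms(1) norm_ge_zero order_trans by blast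
  then show ?thesis using False by (simp add: ell_factor_def)
next
  case True
  have A0: "A \<ge> 0" using assms(1) norm_ge_zero order_trans by blast
  have p2: "real p \<ge> 2" using prime_ge_2_nat[OF True] by simp
  define a where "a = z - 1"
  define v where "v = 1 / real p"
  have v: "0 < v" "v \<le> 1/2" using p2 by (auto simp: v_def field_simps)
  define F where "F = (\<lambda>w::real. (1 + a * of_real w) * exp (a * of_real (ln (1 - w))))"
  define F' where "F' = (\<lambda>w::real. - a * (1 + a) * of_real (w / (1 - w)) * exp (a * of_real (ln (1 - w))))"
  define B where "B = 2 * A * (1 + A) * 2 powr A * v"
  have der: "(F has_vector_derivative F' w) (at w within {0..v})" if "w \<in> {0..v}" for w
  proof -
    have w: "w < 1" using that v by auto
    have "((\<lambda>x. of_real (ln (1 - x)) :: complex) has_vector_derivative of_real (- 1 / (1 - w))) (at w within {0..v})"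
      by (rule has_vector_derivative_of_real) (use w in \<open>auto intro!: derivative_eq_intros\<close>)
    then have "((\<lambda>x. a * of_real (ln (1 - x))) has_vector_derivative a * of_real (- 1 / (1 - w))) (at w within {0..v})"
      by (rule has_vector_derivative_mult_right)
    from field_vector_diff_chain_within[OF this has_field_derivative_at_within[OF DERIV_exp]]
    have "((\<lambda>x. exp (a * of_real (ln (1 - x)))) has_vector_derivative
         (a * of_real (- 1 / (1 - w))) * exp (a * of_real (ln (1 - w)))) (at w within {0..v})"
      by (simp add: o_def)
    moreover have "((\<lambda>x. 1 + a * of_real x) has_vector_derivative a) (at w within {0..v})"
      by (auto intro!: derivative_eq_intros)
    ultimately have "(F has_vector_derivative (1 + a * of_real w) * ((a * of_real (- 1 / (1 - w))) * exp (a * of_real (ln (1 - w))))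
         + a * exp (a * of_real (ln (1 - w)))) (at w within {0..v})"
      unfolding F_def by (rule has_vector_derivative_mult[rotated])
    moreover have "(1 + a * of_real w) * ((a * of_real (- 1 / (1 - w))) * e) + a * e
       = - a * (1 + a) * of_real (w / (1 - w)) * e" for e
    proof -
      have "1 - (of_real w :: complex) \<noteq> 0"
        using w by (metis eq_iff_diff_eq_0 less_irrefl of_real_1 of_real_eq_iff)
      then show ?thesis by (simp add: field_simps)
    qed
    ultimately show ?thesis by (simp add: F'_def)
  qed
  have bnd: "norm (F' w) \<le> B" if "w \<in> {0..v}" for w
  proof -
    have w: "0 \<le> w" "w \<le> 1/2" "w \<le> v" using that v by auto
    have "norm (1 + a) \<le> 1 + A" using assms(1) norm_triangle_ineq[of 1 a] by (simp add: a_def)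
    moreover have "w / (1 - w) \<le> 2 * v"
    proof -
      have "w / (1 - w) \<le> v / (1/2)" using w v by (intro frac_le) auto
      then show ?thesis by simp
    qed
    moreover have "norm (of_real (w / (1 - w)) :: complex) = w / (1 - w)"
      using w by (subst norm_of_real) auto
    moreover have "norm (exp (a * of_real (ln (1 - w)))) \<le> 2 powr A"
      using norm_exp_ln_le[of a A w] assms w by (auto simp: a_def)
    moreover have "norm a \<le> A" using assms by (simp add: a_def)
    ultimately have "norm (F' w) \<le> A * (1 + A) * (2 * v) * 2 powr A"
      unfolding F'_def norm_mult norm_minus_cancel using A0 v w by (intro mult_mono) auto
    then show ?thesis by (simp add: B_def mult_ac)
  qed
  have "norm (F v - F 0) \<le> B * norm (v - 0)"
  proof (rule differentiable_bound[of "{0..v}"])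
    show "(F has_derivative (\<lambda>h. h *\<^sub>R F' x)) (at x within {0..v})" if "x \<in> {0..v}" for x
      using der[OF that] by (simp add: has_vector_derivative_def)
    show "onorm (\<lambda>h. h *\<^sub>R F' x) \<le> B" if "x \<in> {0..v}" for x
      using bnd[OF that] by (intro onorm_le) (metis mult.commute mult_right_mono norm_scaleR norm_ge_zero real_norm_def)
  qed (use v in auto)
  moreover have "Ln (of_real (1 - v)) = of_real (ln (1 - v))"
    by (rule Ln_of_real) (use v in simp)
  then have "ell_factor z p = F v"
    using True v by (auto simp: ell_factor_def F_def a_def v_def powr_def)
  moreover have "F 0 = 1" by (simp add: F_def)
  ultimately show ?thesis using v(1) by (simp add: B_def v_def power2_eq_square field_simps)
qed

lemma one_minus_inverse_prime_nonzero:
  "prime p \<Longrightarrow> complex_of_real (1 - 1 / real p) \<noteq> 0"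
  using prime_gt_1_nat[of p] unfolding of_real_eq_0_iff by (auto simp: field_simps)

lemma ell_factor_holomorphic: "(\<lambda>z. ell_factor z p) holomorphic_on A"
proof (cases "prime p")
  case True
  then have "(\<lambda>z. (1 + (z - 1) / of_nat p) * exp ((z - 1) * ln (complex_of_real (1 - 1 / real p)))) holomorphic_on A"
    by (intro holomorphic_intros) (simp add: prime_gt_0_nat)
  then show ?thesis
    unfolding ell_factor_def powr_def using True one_minus_inverse_prime_nonzero[OF True] by simp
qed (auto simp: ell_factor_def)

lemma ell_factor_0 [simp]: "ell_factor z 0 = 1"
  by (simp add: ell_factor_def)

lemma norm_ell_factor_minus_1_le':
  assumes "norm (z - 1) \<le> A"
  shows "norm (ell_factor z p - 1) \<le> 2 * A * (1 + A) * 2 powr A * inverse (real p ^ 2)"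
  \<comment> \<open>At \<open>p = 0\<close> both sides are 0, because
    \<open>inverse 0 = 0\<close>.\<close>
  using norm_ell_factor_minus_1_le[OF assms, of p] by (cases p) auto

lemma convergent_prod_ell_factor: "convergent_prod (ell_factor z)"
proof -
  have "summable (\<lambda>p. norm (ell_factor z p - 1))"
  proof (rule summable_comparison_test_ev)
    let ?A = "norm (z - 1)"
    show "summable (\<lambda>p. 2 * ?A * (1 + ?A) * 2 powr ?A * inverse (real p ^ 2))"
      by (intro summable_mult inverse_power_summable) auto
    show "\<forall>\<^sub>F p in sequentially. norm (norm (ell_factor z p - 1)) \<le> 2 * ?A * (1 + ?A) * 2 powr ?A * inverse (real p ^ 2)"
      using norm_ell_factor_minus_1_le'[of z ?A] by simp
  qed
  then show ?thesis
    by (intro abs_convergent_prod_imp_convergent_prod) (simp add: abs_convergent_prod_conv_summable)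
qed

text \<open>The bound of order 1/p^2 depends on \<open>z\<close> only through an upper bound for
  \<open>norm (z - 1)\<close>, so the Weierstrass test applies on every disc of radius 1. Zeros of
  factors do no harm, since the partial products themselves converge uniformly.\<close>

lemma prodinf_ell_factor_holomorphic: "(\<lambda>z. \<Prod>p. ell_factor z p) holomorphic_on UNIV"
proof (rule holomorphic_uniform_sequence[where f = "\<lambda>N z. \<Prod>p<N. ell_factor z p"])
  fix z0 :: complex assume "z0 \<in> UNIV"
  have "uniformly_convergent_on (cball z0 1) (\<lambda>N z. \<Prod>p<N. ell_factor z p)"
  proof (rule uniformly_convergent_on_prod')
    let ?A = "norm (z0 - 1) + 1"
    show "uniformly_convergent_on (cball z0 1) (\<lambda>N z. \<Sum>n<N. norm (ell_factor z n - 1))"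
    proof (rule Weierstrass_m_test')
      show "summable (\<lambda>p. 2 * ?A * (1 + ?A) * 2 powr ?A * inverse (real p ^ 2))"
        by (intro summable_mult inverse_power_summable) auto
      fix p z assume "z \<in> cball z0 1"
      then have "norm (z - 1) \<le> ?A"
        using norm_triangle_ineq[of "z - z0" "z0 - 1"] by (simp add: dist_norm norm_minus_commute)
      from norm_ell_factor_minus_1_le'[OF this]
      show "norm (norm (ell_factor z p - 1)) \<le> 2 * ?A * (1 + ?A) * 2 powr ?A * inverse (real p ^ 2)" by simp
    qed
    show "continuous_on (cball z0 1) (\<lambda>z. ell_factor z n)" for n
      by (intro holomorphic_on_imp_continuous_on ell_factor_holomorphic)
  qed auto
  moreover have "(\<Prod>p. ell_factor z p) = lim (\<lambda>N. \<Prod>p<N. ell_factor z p)" for z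
  proof -
    have "(\<lambda>N. \<Prod>p\<le>N. ell_factor z p) \<longlonglongrightarrow> (\<Prod>p. ell_factor z p)"
      by (rule convergent_prod_LIMSEQ[OF convergent_prod_ell_factor])
    then have "(\<lambda>N. \<Prod>p<Suc N. ell_factor z p) \<longlonglongrightarrow> (\<Prod>p. ell_factor z p)"
      by (simp only: lessThan_Suc_atMost)
    then have "(\<lambda>N. \<Prod>p<N. ell_factor z p) \<longlonglongrightarrow> (\<Prod>p. ell_factor z p)"
      by (rule LIMSEQ_imp_Suc)
    from limI[OF this] show ?thesis ..
  qed
  ultimately have "uniform_limit (cball z0 1) (\<lambda>N z. \<Prod>p<N. ell_factor z p) (\<lambda>z. \<Prod>p. ell_factor z p) sequentially"
    by (simp add: uniformly_convergent_uniform_limit_iff)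
  then show "\<exists>d>0. cball z0 d \<subseteq> UNIV \<and> uniform_limit (cball z0 d) (\<lambda>N z. \<Prod>p<N. ell_factor z p) (\<lambda>z. \<Prod>p. ell_factor z p) sequentially"
    by (intro exI[of _ 1]) auto
qed (auto intro!: holomorphic_intros ell_factor_holomorphic)

lemma ell_analytic: "ell analytic_on UNIV"
proof -
  have "ell holomorphic_on UNIV"
    unfolding ell_def[abs_def] by (intro holomorphic_intros prodinf_ell_factor_holomorphic)
  then show ?thesis by (simp add: analytic_on_open)
qed

text \<open>A convergent product vanishes only if one of its factors does, and the factor at
  \<open>p\<close> vanishes only where z - 1 + p = 0.\<close>

lemma ell_nonzero:
  assumes "\<forall>p::nat. prime p \<longrightarrow> z \<noteq> 1 - of_nat p"
  shows "ell z \<noteq> 0"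
proof -
  have "ell_factor z p \<noteq> 0" for p
  proof (cases "prime p")
    case True
    then have p: "p > 1" by (rule prime_gt_1_nat)
    have "z - 1 + of_nat p \<noteq> 0"
      using assms True by (auto simp: algebra_simps add_eq_0_iff)
    moreover have "1 + (z - 1) / of_nat p = (z - 1 + of_nat p) / of_nat p"
      using p by (simp add: field_simps)
    ultimately have "1 + (z - 1) / of_nat p \<noteq> 0" using p by simp
    moreover have "complex_of_real (1 - 1 / real p) powr (z - 1) \<noteq> 0"
      using one_minus_inverse_prime_nonzero[OF True] by (simp del: of_real_diff of_real_divide)
    ultimately show ?thesis using True by (simp add: ell_factor_def)
  qed (simp add: ell_factor_def)
  then show ?thesis
    unfolding ell_def using prodinf_nonzero[OF convergent_prod_ell_factor] by simp
qed

text \<open>Moving one factor 1 - 1/p out of the power turns 1 + z/(p - 1) into 1 + (z -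
  1)/p.\<close>

lemma ell_eq_g1: "ell z = exp ((z - 1) * euler_mascheroni) * g1 z"
proof -
  have "(if prime p then (1 + z / (of_nat p - 1)) * complex_of_real (1 - 1 / real p) powr z else 1)
     = ell_factor z p" for p
  proof (cases "prime p")
    case True
    then have p: "p > 1" by (rule prime_gt_1_nat)
    define b where "b = complex_of_real (1 - 1 / real p)"
    have b0: "b \<noteq> 0" unfolding b_def by (rule one_minus_inverse_prime_nonzero[OF True])
    have pp: "(of_nat p :: complex) - 1 \<noteq> 0" "(of_nat p :: complex) \<noteq> 0" using p by auto
    have "b powr z = b powr (z - 1) * b" using b0 by (simp add: powr_diff)
    moreover have "(1 + z / (of_nat p - 1)) * b = 1 + (z - 1) / of_nat p"
      using pp by (simp add: b_def field_simps)
    ultimately have "(1 + z / (of_nat p - 1)) * b powr z = (1 + (z - 1) / of_nat p) * b powr (z - 1)"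
      by (metis mult.assoc mult.commute)
    then show ?thesis using True unfolding ell_factor_def b_def by metis
  qed (simp add: ell_factor_def)
  then show ?thesis by (simp add: ell_def g1_def)
qed

section \<open>The entire exponential integral\<close>

text \<open>The value 1 at 0 fills the removable singularity, so that \<open>Ein\<close> is
  continuous down to 0, where one of the two limits of the Laplace transform is taken.\<close>

definition Ein_integrand :: "real \<Rightarrow> real" where
  "Ein_integrand x = (if x = 0 then 1 else (1 - exp (- x)) / x)"

definition Ein :: "real \<Rightarrow> real" where
  "Ein s = integral {0..s} Ein_integrand"

lemma continuous_Ein_integrand: "isCont Ein_integrand x"
proof (cases "x = 0")
  case True
  have "((\<lambda>x::real. exp (- x)) has_real_derivative -1) (at 0)"
    by (auto intro!: derivative_eq_intros)
  then have "((\<lambda>x. (exp (- x) - 1) / x) \<longlongrightarrow> -1) (at (0::real))"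
    by (simp add: has_field_derivative_iff)
  then have "((\<lambda>x. - ((exp (- x) - 1) / x)) \<longlongrightarrow> - (-1)) (at (0::real))"
    by (rule tendsto_minus)
  moreover have "\<forall>\<^sub>F x in at 0. - ((exp (- x) - 1) / x) = Ein_integrand x"
    by (auto simp: eventually_at_filter Ein_integrand_def field_simps)
  ultimately have "(Ein_integrand \<longlongrightarrow> 1) (at 0)"
    by (simp add: filterlim_cong)
  then show ?thesis using True by (simp add: isCont_def Ein_integrand_def)
next
  case False
  then have "\<forall>\<^sub>F y in nhds x. Ein_integrand y = (1 - exp (- y)) / y"
    by (intro eventually_mono[OF t1_space_nhds[of x 0]]) (auto simp: Ein_integrand_def)
  then show ?thesis using False
    by (subst isCont_cong) (auto intro!: continuous_intros)
qed

lemma continuous_on_Ein_integrand: "continuous_on A Ein_integrand"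
  by (simp add: continuous_Ein_integrand continuous_at_imp_continuous_on)

lemma Ein_integrand_integrable: "Ein_integrand integrable_on {a..b}"
  by (intro integrable_continuous_real continuous_on_Ein_integrand)

lemma continuous_on_Ein: "continuous_on {0..b} Ein"
  unfolding Ein_def by (intro indefinite_integral_continuous_1 Ein_integrand_integrable)

lemma Ein_0 [simp]: "Ein 0 = 0"
  by (simp add: Ein_def)

lemma Ein_has_real_derivative:
  assumes "s > 0"
  shows "(Ein has_real_derivative (1 - exp (- s)) / s) (at s)"
proof -
  have "(Ein has_vector_derivative Ein_integrand s) (at s within {0..s+1})"
    unfolding Ein_def
    by (rule integral_has_vector_derivative[OF continuous_on_Ein_integrand]) (use assms in auto)
  then have "(Ein has_vector_derivative Ein_integrand s) (at s)"
    using assms by (subst (asm) at_within_interior) auto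
  then show ?thesis
    using assms by (simp add: has_real_derivative_iff_has_vector_derivative Ein_integrand_def)
qed

text \<open>The second bound is Bernoulli's inequality for (1 - y^2)^n = (1 - y)^n (1 + y)^n,
  combined with 1 + y \<le> exp y. The difference estimated here is y times the derivative of the
  interpolation between \<open>harm n\<close> and \<open>Ein n\<close>.\<close>

lemma exp_minus_power_bounds:
  fixes y :: real
  assumes "0 \<le> y" "y \<le> 1"
  shows "(1 - y) ^ n \<le> exp (- (real n * y))"
    and "exp (- (real n * y)) - (1 - y) ^ n \<le> real n * y\<^sup>2 * exp (- (real n * y))"
proof -
  have "(1 - y) ^ n \<le> exp (- y) ^ n"
    using assms exp_ge_add_one_self[of "-y"] by (intro power_mono) auto
  then show "(1 - y) ^ n \<le> exp (- (real n * y))"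
    by (simp add: exp_of_nat_mult[symmetric])
  have "1 - real n * y\<^sup>2 \<le> (1 - y\<^sup>2) ^ n"
    using Bernoulli_inequality[of "- y\<^sup>2" n] assms by (simp add: power_le_one)
  also have "\<dots> = (1 - y) ^ n * (1 + y) ^ n"
    by (simp add: power_mult_distrib[symmetric] power2_eq_square algebra_simps)
  also have "\<dots> \<le> (1 - y) ^ n * exp y ^ n"
    using assms by (intro mult_left_mono power_mono) (auto simp: exp_ge_add_one_self)
  also have "exp y ^ n = exp (real n * y)"
    by (simp add: exp_of_nat_mult)
  finally have "(1 - real n * y\<^sup>2) * exp (- (real n * y)) \<le> (1 - y) ^ n * exp (real n * y) * exp (- (real n * y))"
    by (intro mult_right_mono) auto
  then show "exp (- (real n * y)) - (1 - y) ^ n \<le> real n * y\<^sup>2 * exp (- (real n * y))"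
    by (simp add: algebra_simps exp_minus)
qed

text \<open>
  Both bounds compare derivatives in \<open>y\<close> on \<open>[0, 1]\<close>:
  \<open>\<Sum>k<n. (1 - (1 - y) ^ (k + 1)) / (k + 1)\<close> interpolates between 0 and \<open>harm n\<close>,
  and \<open>Ein (n * y)\<close> between 0 and \<open>Ein n\<close>.
\<close>

lemma harm_minus_Ein_bounds:
  assumes "n > 0"
  shows "harm n - Ein (real n) \<ge> 0" "harm n - Ein (real n) \<le> 1 / real n"
proof -
  define D where "D = (\<lambda>y. (\<Sum>k<n. (1 - (1 - y) ^ Suc k) / real (Suc k)) - Ein (real n * y))"
  define D' where "D' = (\<lambda>y. (exp (- (real n * y)) - (1 - y) ^ n) / y)"
  have n: "real n > 0" using assms by simp
  have cont: "continuous_on {0..1} D"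
    unfolding D_def
    by (intro continuous_intros continuous_on_compose2[OF continuous_on_Ein[of "real n"]])
       (use n in \<open>auto simp: mult_left_le\<close>)
  have der: "(D has_real_derivative D' y) (at y)" if y: "0 < y" "y < 1" for y
  proof -
    have "((\<lambda>y. Ein (real n * y)) has_real_derivative (1 - exp (- (real n * y))) / (real n * y) * real n) (at y)"
      using DERIV_chain2[OF Ein_has_real_derivative, of "\<lambda>y. real n * y" y "real n" UNIV] y n
      by (auto intro!: derivative_eq_intros)
    moreover have "((\<lambda>y. \<Sum>k<n. (1 - (1 - y) ^ Suc k) / real (Suc k)) has_real_derivative (\<Sum>k<n. (1 - y) ^ k)) (at y)"
      by (intro DERIV_sum) (auto intro!: derivative_eq_intros simp del: power_Suc of_nat_Suc)
    ultimately have "(D has_real_derivative (\<Sum>k<n. (1 - y) ^ k) - (1 - exp (- (real n * y))) / (real n * y) * real n) (at y)"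
      unfolding D_def by (intro DERIV_diff)
    moreover have "(\<Sum>k<n. (1 - y) ^ k) = (1 - (1 - y) ^ n) / y"
      using y by (simp add: sum_gp_strict)
    moreover have "(1 - (1 - y) ^ n) / y - (1 - exp (- (real n * y))) / (real n * y) * real n = D' y"
      using n y by (simp add: D'_def diff_divide_distrib left_diff_distrib)
    ultimately show ?thesis by simp
  qed
  have D0: "D 0 = 0" by (simp add: D_def)
  have D1: "D 1 = harm n - Ein (real n)"
  proof -
    have "(\<Sum>k<n. 1 / real (Suc k)) = harm n"
      unfolding harm_def atLeastLessThanSuc_atLeastAtMost[symmetric]
      by (rule sum.reindex_bij_witness[of _ "\<lambda>k. k - 1" Suc]) (auto simp: field_simps)
    then show ?thesis by (simp add: D_def)
  qed
  have "D 0 \<le> D 1"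
  proof (rule DERIV_nonneg_imp_increasing_open[OF _ _ cont])
    fix y :: real assume y: "0 < y" "y < 1"
    then have "D' y \<ge> 0"
      using exp_minus_power_bounds(1)[of y n] by (simp add: D'_def)
    then show "\<exists>l. (D has_real_derivative l) (at y) \<and> 0 \<le> l" using der[OF y] by blast
  qed simp
  then show "harm n - Ein (real n) \<ge> 0" using D0 D1 by simp
  \<comment> \<open>-(y + 1/n) exp(-n y) is an antiderivative of n y exp(-n y), the upper bound for
    \<open>D'\<close>. So \<open>V\<close> increases, and its value -1/n at 0 is the source of the
    final bound.\<close>
  define V where "V = (\<lambda>y. - (y + 1 / real n) * exp (- (real n * y)) - D y)"
  have contV: "continuous_on {0..1} V"
    unfolding V_def by (intro continuous_intros cont)
  have "V 0 \<le> V 1"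
  proof (rule DERIV_nonneg_imp_increasing_open[OF _ _ contV])
    fix y :: real assume y: "0 < y" "y < 1"
    have "(V has_real_derivative real n * y * exp (- (real n * y)) - D' y) (at y)"
      unfolding V_def using n by (auto intro!: derivative_eq_intros der[OF y] simp: field_simps)
    moreover have "D' y \<le> real n * y * exp (- (real n * y))"
      using exp_minus_power_bounds(2)[of y n] y by (simp add: D'_def field_simps power2_eq_square)
    ultimately show "\<exists>l. (V has_real_derivative l) (at y) \<and> 0 \<le> l" by force
  qed simp
  moreover have "V 1 \<le> - D 1" using n unfolding V_def mult_minus_left by simp
  moreover have "V 0 = - (1 / real n)" using D0 by (simp add: V_def)
  ultimately show "harm n - Ein (real n) \<le> 1 / real n" using D1 by simp
qed

lemma Ein_minus_ln_LIMSEQ: "(\<lambda>n. Ein (real n) - ln (real n)) \<longlonglongrightarrow> euler_mascheroni"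
proof -
  have "(\<lambda>n. harm n - Ein (real n)) \<longlonglongrightarrow> 0"
  proof (rule tendsto_sandwich[OF _ _ tendsto_const lim_1_over_n])
    show "\<forall>\<^sub>F n in sequentially. 0 \<le> harm n - Ein (real n)"
      using eventually_gt_at_top[of 0] by eventually_elim (rule harm_minus_Ein_bounds)
    show "\<forall>\<^sub>F n in sequentially. harm n - Ein (real n) \<le> 1 / real n"
      using eventually_gt_at_top[of 0] by eventually_elim (rule harm_minus_Ein_bounds)
  qed
  from tendsto_diff[OF euler_mascheroni_LIMSEQ this] show ?thesis by simp
qed

lemma Ein_inverse_LIMSEQ: "(\<lambda>n. Ein (1 / real n)) \<longlonglongrightarrow> 0"
proof -
  have "(\<lambda>n. Ein (1 / real n)) \<longlonglongrightarrow> Ein 0"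
    by (rule continuous_on_tendsto_compose[OF continuous_on_Ein[of 1] lim_1_over_n])
       (auto intro!: eventually_sequentiallyI[of 1])
  then show ?thesis by simp
qed

section \<open>The delay equation\<close>

text \<open>This is the value of m at 1 and the coefficient of t^(z - 1) in its continuation to the
  left.\<close>

definition mcoeff :: "complex \<Rightarrow> complex" where
  "mcoeff z = g1 z / Gamma z"

text \<open>
  The first branch of the definition of \<open>mfun\<close> turns into the second, with 1 in place of 2,
  once \<open>mfun\<close> is continued to the interval from 0 to 1 by a multiple of \<open>t powr (z - 1)\<close>.
\<close>

definition mext :: "complex \<Rightarrow> real \<Rightarrow> complex" where
  "mext z t = (if t \<le> 0 then 0 else if t \<le> 1 then mcoeff z * of_real t powr (z - 1) else mfun z t)"

text \<open>A single kernel serves both branches of the recursion: on [1, 2] it is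
  \<open>mcoeff z\<close> times the singular integrand, and from 2 on it is the delayed one.\<close>

definition mkernel :: "complex \<Rightarrow> real \<Rightarrow> complex" where
  "mkernel z u = mext z (u - 1) / of_real u powr z"

lemma of_real_powr_has_vector_derivative:
  assumes "t > 0"
  shows "((\<lambda>t. of_real t powr (a::complex)) has_vector_derivative a / of_real t * of_real t powr a) (at t within S)"
proof -
  have "((\<lambda>w::complex. w powr a) has_field_derivative a * of_real t powr (a - 1)) (at (of_real t))"
    by (rule has_field_derivative_powr) (use assms in auto)
  from has_vector_derivative_real_field[OF this, of S] show ?thesis
    using assms by (simp add: powr_diff)
qed

lemma continuous_on_of_real_powr: "continuous_on {0<..} (\<lambda>t. of_real t powr (a::complex))"
  by (intro continuous_at_imp_continuous_on ballI
        has_vector_derivative_continuous[OF of_real_powr_has_vector_derivative]) auto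

context
  fixes z :: complex
  assumes Re_z: "Re z > 0"
begin

lemma z_neq_0: "z \<noteq> 0"
  using Re_z by auto

text \<open>At u = 1 the base is 0; continuity there is where \<open>Re z > 0\<close>
  enters.\<close>

lemma continuous_on_ratio_powr:
  "continuous_on {1..b} (\<lambda>u::real. of_real ((u - 1) / u) powr z)"
  by (rule continuous_on_powr_complex) (auto intro!: continuous_intros simp: Re_z)

lemma norm_ratio_powr_le:
  assumes "u \<ge> (1::real)"
  shows "norm (of_real ((u - 1) / u) powr z) \<le> 1"
  using assms Re_z powr_mono2[of "Re z" "(u - 1) / u" 1]
  by (subst norm_powr_real_powr) (auto simp del: of_real_divide of_real_diff)

text \<open>
  The singular integral is evaluated by parts, starting from the antiderivative
  \<open>((u - 1) / u) powr z / z\<close> of \<open>((u - 1) / u) powr (z - 1) / u ^ 2\<close>. The factor \<open>1 / z\<close>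
  is cancelled by the zero of \<open>1 / Gamma z\<close>, which makes the estimates uniform near \<open>z = 0\<close>.
\<close>

lemma has_integral_singular:
  assumes "t \<ge> 1"
  shows "((\<lambda>u. 1 / (of_real u powr z * of_real (u - 1) powr (1 - z))) has_integral
          (of_real t * of_real ((t - 1) / t) powr z
            - integral {1..t} (\<lambda>u. of_real ((u - 1) / u) powr z)) / z) {1..t}"
proof -
  define P where "P = (\<lambda>u::real. complex_of_real ((u - 1) / u) powr z)"
  \<comment> \<open>Since u P' = z P / (u - 1), and the term P from the product rule is cancelled by
    the derivative of the integral, U' = P / (u - 1), which is the integrand.\<close>
  define U where "U = (\<lambda>u. (of_real u * P u - integral {1..u} P) / z)"
  have contP: "continuous_on {1..t} P"
    unfolding P_def by (rule continuous_on_ratio_powr)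
  have "((\<lambda>u. 1 / (of_real u powr z * of_real (u - 1) powr (1 - z))) has_integral (U t - U 1)) {1..t}"
  \<comment> \<open>Only continuity is required at the endpoints: the derivative may blow up at
    1.\<close>
  proof (rule fundamental_theorem_of_calculus_interior_strong[of "{}"])
    show "continuous_on {1..t} U"
      unfolding U_def
      by (intro continuous_intros contP indefinite_integral_continuous_1 integrable_continuous_real ballI z_neq_0)
    fix u assume "u \<in> {1<..<t} - {}"
    then have u: "1 < u" "u < t" by auto
    have P_eq: "P u = exp (z * of_real (ln (u - 1) - ln u))" if "u > 1" for u
      using that by (simp add: P_def powr_def Ln_of_real ln_div del: of_real_divide of_real_diff)
    have "((\<lambda>u. z * of_real (ln (u - 1) - ln u)) has_vector_derivative
            z * of_real (1 / (u - 1) - 1 / u)) (at u)"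
      by (intro has_vector_derivative_mult_right has_vector_derivative_of_real)
         (use u in \<open>auto intro!: derivative_eq_intros\<close>)
    from field_vector_diff_chain_within[OF this has_field_derivative_at_within[OF DERIV_exp]]
    have "((\<lambda>u. exp (z * of_real (ln (u - 1) - ln u))) has_vector_derivative
             z * of_real (1 / (u - 1) - 1 / u) * P u) (at u)"
      using u by (simp add: o_def P_eq)
    then have dP: "(P has_vector_derivative z * of_real (1 / (u - 1) - 1 / u) * P u) (at u)"
      by (rule has_vector_derivative_transform_within_open[where S = "{1<..}"])
         (use u in \<open>auto simp: P_eq\<close>)
    have "((\<lambda>u. integral {1..u} P) has_vector_derivative P u) (at u within {1..t})"
      by (rule integral_has_vector_derivative[OF contP]) (use u in auto)
    then have dI: "((\<lambda>u. integral {1..u} P) has_vector_derivative P u) (at u)"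
      using u by (subst (asm) at_within_interior) auto
    have "(U has_vector_derivative
        (of_real u * (z * of_real (1 / (u - 1) - 1 / u) * P u) + 1 * P u - P u) / z) (at u)"
      unfolding U_def
      by (intro has_vector_derivative_divide has_vector_derivative_diff dI has_vector_derivative_mult dP)
         (auto intro!: derivative_eq_intros)
    moreover have "(of_real u * (z * of_real (1 / (u - 1) - 1 / u) * P u) + 1 * P u - P u) / z
        = P u / of_real (u - 1)"
    proof -
      have "of_real u * of_real (1 / (u - 1) - 1 / u) = (of_real (u * (1 / (u - 1) - 1 / u)) :: complex)"
        by simp
      also have "u * (1 / (u - 1) - 1 / u) = 1 / (u - 1)"
        using u by (simp add: field_simps)
      finally have "of_real u * of_real (1 / (u - 1) - 1 / u) = 1 / (of_real (u - 1) :: complex)"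
        by simp
      then show ?thesis using z_neq_0 by (simp add: mult_ac del: of_real_diff of_real_divide)
    qed
    moreover have "P u / of_real (u - 1) = 1 / (of_real u powr z * of_real (u - 1) powr (1 - z))"
    proof -
      have "P u = of_real (u - 1) powr z / of_real u powr z"
        unfolding P_eq[OF u(1)] of_real_diff[of "ln (u - 1)"] right_diff_distrib exp_diff
        using u by (simp add: powr_def Ln_of_real del: of_real_diff)
      moreover have "of_real (u - 1) powr (1 - z) = of_real (u - 1) / of_real (u - 1) powr z"
        using u by (simp add: powr_diff)
      ultimately show ?thesis using u by (simp del: of_real_diff)
    qed
    ultimately show "(U has_vector_derivative 1 / (of_real u powr z * of_real (u - 1) powr (1 - z))) (at u)"
      by simp
  qed (use assms in auto)
  moreover have "U 1 = 0" by (simp add: U_def P_def)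
  ultimately show ?thesis by (simp add: U_def P_def)
qed

lemma mkernel_singular:
  assumes "1 \<le> u" "u \<le> 2"
  shows "mkernel z u = mcoeff z * (1 / (of_real u powr z * of_real (u - 1) powr (1 - z)))"
proof (cases "u = 1")
  case False
  have "of_real (u - 1) powr (1 - z) = inverse (complex_of_real (u - 1) powr (z - 1))"
    by (metis minus_diff_eq powr_minus)
  then show ?thesis
    using assms False by (simp add: mkernel_def mext_def inverse_eq_divide mult.commute del: of_real_diff)
\<comment> \<open>At u = 1 both sides are 0 by convention: \<open>mext z 0 = 0\<close>, and the
  other denominator contains a power of 0.\<close>
qed (simp add: mkernel_def mext_def)

text \<open>Both the integrability of the kernel at 1 and bounds uniform in \<open>z\<close> are
  read off this value, since \<open>rGamma\<close> is entire.\<close>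

lemma has_integral_mkernel:
  assumes "1 \<le> t" "t \<le> 2"
  shows "(mkernel z has_integral g1 z * rGamma (z + 1) *
          (of_real t * of_real ((t - 1) / t) powr z
            - integral {1..t} (\<lambda>u. of_real ((u - 1) / u) powr z))) {1..t}"
proof -
  have "1 / Gamma z = z * rGamma (z + 1)"
    by (metis rGamma_plus1 rGamma_inverse_Gamma divide_inverse mult_1)
  then have "mcoeff z = g1 z * (z * rGamma (z + 1))"
    unfolding mcoeff_def by (metis times_divide_eq_right mult.right_neutral)
  then have c: "mcoeff z * (w / z) = g1 z * rGamma (z + 1) * w" for w
    using z_neq_0 by simp
  show ?thesis
    by (rule has_integral_eq[OF _ has_integral_mult_right[OF has_integral_singular[OF assms(1)],
          of "mcoeff z", unfolded c]])
       (rule mkernel_singular[symmetric], use assms in auto)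
qed

section \<open>One integral formula for both branches, and regularity on the half-line\<close>

lemma mfun_le_2:
  assumes "1 \<le> t" "t \<le> 2"
  shows "mfun z t = of_real t powr (z - 1) * (mcoeff z - (z - 1) * integral {1..t} (mkernel z))"
proof -
  have "integral {1..t} (mkernel z) =
      integral {1..t} (\<lambda>u. mcoeff z * (1 / (of_real u powr z * of_real (u - 1) powr (1 - z))))"
    by (rule integral_cong, rule mkernel_singular) (use assms in auto)
  also have "\<dots> = mcoeff z * integral {1..t} (\<lambda>u. 1 / (of_real u powr z * of_real (u - 1) powr (1 - z)))"
    by (rule integral_mult_right)
  finally show ?thesis
    using assms by (subst mfun.simps) (simp add: mcoeff_def[symmetric] algebra_simps)
qed

lemma mfun_1: "mfun z 1 = mcoeff z"
  by (simp add: mfun_le_2)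

lemma mext_eq_mfun: "t \<ge> 1 \<Longrightarrow> mext z t = mfun z t"
  by (cases "t = 1") (auto simp: mext_def mfun_1)

text \<open>The three claims need each other: continuity of m on one interval makes the kernel
  integrable on an interval longer by 1, there the integral formula follows, and the formula gives
  continuity again.\<close>

lemma mfun_regular_aux:
  "continuous_on {1..real n + 2} (mfun z) \<and> mkernel z integrable_on {1..real n + 2} \<and>
   (\<forall>t\<in>{1..real n + 2}. mfun z t = of_real t powr (z - 1) * (mcoeff z - (z - 1) * integral {1..t} (mkernel z)))"
proof (induction n)
  case 0
  have int: "mkernel z integrable_on {1..2}"
    using has_integral_mkernel[of 2] by (auto simp: integrable_on_def)
  have "continuous_on {1..2} (\<lambda>t. of_real t powr (z - 1) * (mcoeff z - (z - 1) * integral {1..t} (mkernel z)))"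
    by (intro continuous_on_mult continuous_on_diff continuous_on_const indefinite_integral_continuous_1 int
          continuous_on_subset[OF continuous_on_of_real_powr]) auto
  then have "continuous_on {1..2} (mfun z)"
    by (rule continuous_on_eq) (simp add: mfun_le_2)
  then show ?case using int mfun_le_2 by auto
next
  case (Suc n)
  let ?b = "real n + 2"
  have b: "real (Suc n) + 2 = ?b + 1" by simp
  have kernel: "mkernel z u = mfun z (u - 1) / of_real u powr z" if "u \<ge> 2" for u
    using that by (simp add: mkernel_def mext_eq_mfun)
  have "continuous_on {2..?b + 1} (\<lambda>u. mfun z (u - 1) / of_real u powr z)"
  proof (rule continuous_on_divide)
    show "continuous_on {2..?b + 1} (\<lambda>u. mfun z (u - 1))"
      by (rule continuous_on_compose2[of "{1..?b}" "mfun z"]) (use Suc.IH in \<open>auto intro!: continuous_intros\<close>)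
    show "continuous_on {2..?b + 1} (\<lambda>u. of_real u powr z)"
      by (rule continuous_on_subset[OF continuous_on_of_real_powr]) auto
  qed auto
  then have "continuous_on {2..?b + 1} (mkernel z)"
    by (rule continuous_on_eq) (simp add: kernel)
  then have "mkernel z integrable_on {2..?b + 1}"
    by (rule integrable_continuous_real)
  moreover have int2: "mkernel z integrable_on {1..2}"
    using has_integral_mkernel[of 2] by (auto simp: integrable_on_def)
  ultimately have int: "mkernel z integrable_on {1..?b + 1}"
    using Henstock_Kurzweil_Integration.integrable_combine[of 1 2 "?b + 1"] by simp
  have eq: "mfun z t = of_real t powr (z - 1) * (mcoeff z - (z - 1) * integral {1..t} (mkernel z))"
    if t: "t \<in> {1..?b + 1}" for t
  proof (cases "t \<le> 2")
    case False
    have k: "integral {2..t} (\<lambda>u. mfun z (u - 1) / of_real u powr z) = integral {2..t} (mkernel z)"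
      by (rule integral_cong) (auto simp: kernel)
    have cmb: "integral {1..2} (mkernel z) + integral {2..t} (mkernel z) = integral {1..t} (mkernel z)"
      by (rule Henstock_Kurzweil_Integration.integral_combine) (use False t in \<open>auto intro: integrable_on_subinterval[OF int]\<close>)
    \<comment> \<open>The weight in the second branch of the definition makes its constant term
      equal to the bracket of the formula at t = 2, so the integrals over [1, 2] and [2, t]
      join.\<close>
    have two: "2 powr (1 - z) * mfun z 2 = mcoeff z - (z - 1) * integral {1..2} (mkernel z)"
    proof -
      have "(2::complex) powr (1 - z) * 2 powr (z - 1) = 1"
        by (simp add: powr_add[symmetric])
      then show ?thesis by (simp add: mfun_le_2 mult.assoc[symmetric])
    qed
    have "mfun z t = 2 powr (1 - z) * mfun z 2 * of_real t powr (z - 1)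
        + (1 - z) * of_real t powr (z - 1) * integral {2..t} (\<lambda>u. mfun z (u - 1) / of_real u powr z)"
      using False t by (subst mfun.simps) simp
    then show ?thesis unfolding k two cmb[symmetric] by (simp add: algebra_simps)
  qed (use mfun_le_2 t in auto)
  have "continuous_on {1..?b + 1} (\<lambda>t. of_real t powr (z - 1) * (mcoeff z - (z - 1) * integral {1..t} (mkernel z)))"
    by (intro continuous_on_mult continuous_on_diff continuous_on_const indefinite_integral_continuous_1 int
          continuous_on_subset[OF continuous_on_of_real_powr]) auto
  then have "continuous_on {1..?b + 1} (mfun z)"
    by (rule continuous_on_eq) (rule eq[symmetric])
  then show ?case using int eq unfolding b by auto
qed

lemma mkernel_integrable: "mkernel z integrable_on {1..t}"
proof -
  obtain n where "t \<le> real n" using real_arch_simple by blast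
  moreover have "mkernel z integrable_on {1..real n + 2}"
    using mfun_regular_aux by blast
  ultimately show ?thesis by (elim integrable_on_subinterval) auto
qed

lemma mfun_eq:
  assumes "t \<ge> 1"
  shows "mfun z t = of_real t powr (z - 1) * (mcoeff z - (z - 1) * integral {1..t} (mkernel z))"
proof -
  obtain n where "t \<le> real n" using real_arch_simple by blast
  then have "t \<in> {1..real n + 2}" using assms by simp
  then show ?thesis using mfun_regular_aux by blast
qed

lemma continuous_on_mfun: "continuous_on {1..} (mfun z)"
proof (rule continuous_on_eq[OF _ mfun_eq[symmetric]])
  have "continuous_on {1..} (\<lambda>t. integral {1..t} (mkernel z))"
  proof (rule continuous_on_eq_continuous_within[THEN iffD2], rule ballI)
    fix t :: real assume t: "t \<in> {1..}"
    have "continuous (at t within {1..t + 1}) (\<lambda>t. integral {1..t} (mkernel z))"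
      using indefinite_integral_continuous_1[OF mkernel_integrable, of "t + 1"] t
      by (auto simp: continuous_on_eq_continuous_within)
    moreover have "at t within {1..t + 1} = at t within {1..}"
      by (rule at_within_nhd[of _ "{..<t+1}"]) (use t in auto)
    ultimately show "continuous (at t within {1..}) (\<lambda>t. integral {1..t} (mkernel z))" by simp
  qed
  then show "continuous_on {1..} (\<lambda>t. of_real t powr (z - 1) * (mcoeff z - (z - 1) * integral {1..t} (mkernel z)))"
    by (intro continuous_on_mult continuous_on_diff continuous_on_const
          continuous_on_subset[OF continuous_on_of_real_powr]) auto
qed auto

lemma continuous_on_mext: "continuous_on {0<..} (mext z)"
proof -
  \<comment> \<open>Both pieces are continuous in \<open>t\<close>, and they are glued at 1, where
    both equal \<open>mcoeff z\<close>.\<close>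
  have "mext z t = mcoeff z * of_real (min t 1) powr (z - 1) + (mfun z (max t 1) - mcoeff z)" if "t > 0" for t
    using that by (auto simp: mext_def mfun_1 min_def max_def)
  moreover have "continuous_on {0<..} (\<lambda>t. mcoeff z * of_real (min t 1) powr (z - 1) + (mfun z (max t 1) - mcoeff z))"
    by (intro continuous_intros continuous_on_compose2[OF continuous_on_mfun]
          continuous_on_compose2[OF continuous_on_of_real_powr[of "z - 1"], of _ "\<lambda>t. min t 1"]) auto
  ultimately show ?thesis by (elim continuous_on_eq) auto
qed

lemma isCont_mext: "t > 0 \<Longrightarrow> isCont (mext z) t"
  using continuous_on_mext by (simp add: continuous_on_eq_continuous_at)

text \<open>Below 1 the delayed term is 0 and the pure power satisfies t m' = (z - 1) m. Above 1,
  differentiate t^(z - 1) Q(t), where t^(z - 1) times the kernel collapses to m(t - 1) / t. At t = 1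
  the delayed argument reaches 0, where \<open>mext\<close> need not be continuous.\<close>

lemma mext_has_vector_derivative:
  assumes "t > 0" "t \<noteq> 1"
  shows "(mext z has_vector_derivative (z - 1) / of_real t * (mext z t - mext z (t - 1))) (at t)"
proof (cases "t < 1")
  case True
  have "((\<lambda>t. mcoeff z * of_real t powr (z - 1)) has_vector_derivative
          mcoeff z * ((z - 1) / of_real t * of_real t powr (z - 1))) (at t)"
    by (intro has_vector_derivative_mult_right of_real_powr_has_vector_derivative assms)
  then have "(mext z has_vector_derivative mcoeff z * ((z - 1) / of_real t * of_real t powr (z - 1))) (at t)"
    by (rule has_vector_derivative_transform_within_open[where S = "{0<..<1}"])
       (use assms True in \<open>auto simp: mext_def\<close>)
  then show ?thesis using True assms by (simp add: mext_def mult_ac)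
next
  case False
  then have t: "t > 1" using assms by simp
  have "isCont (mext z) (t - 1)" by (rule isCont_mext) (use t in simp)
  then have "isCont (\<lambda>u. mext z (u - 1)) t"
    using isCont_o2[of t "\<lambda>u. u - 1" "mext z"] by simp
  moreover have "isCont (\<lambda>u. of_real u powr z) t"
    using continuous_on_of_real_powr[of z] t by (simp add: continuous_on_eq_continuous_at)
  ultimately have "isCont (mkernel z) t"
    unfolding mkernel_def[abs_def] using t by (intro continuous_intros) auto
  \<comment> \<open>The kernel may be unbounded near 1, so the fundamental theorem is applied at the
    single point of continuity \<open>t\<close>.\<close>
  then have "continuous (at t within {1..t+1} - {}) (mkernel z)"
    by (rule continuous_at_imp_continuous_at_within)
  then have "((\<lambda>u. integral {1..u} (mkernel z)) has_vector_derivative mkernel z t) (at t within {1..t+1} - {})"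
    using t by (intro integral_has_vector_derivative_continuous_at mkernel_integrable) auto
  then have dI: "((\<lambda>u. integral {1..u} (mkernel z)) has_vector_derivative mkernel z t) (at t)"
    using t by (subst (asm) at_within_interior) auto
  define Q where "Q = (\<lambda>t. mcoeff z - (z - 1) * integral {1..t} (mkernel z))"
  have dQ: "(Q has_vector_derivative (0 - (z - 1) * mkernel z t)) (at t)"
    unfolding Q_def by (intro has_vector_derivative_diff has_vector_derivative_const has_vector_derivative_mult_right dI)
  have m_eq: "mext z t = of_real t powr (z - 1) * Q t" if "t > 1" for t
    using that by (simp add: mext_eq_mfun mfun_eq Q_def)
  have "((\<lambda>t. of_real t powr (z - 1) * Q t) has_vector_derivative
      of_real t powr (z - 1) * (0 - (z - 1) * mkernel z t)
        + (z - 1) / of_real t * of_real t powr (z - 1) * Q t) (at t)"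
    by (intro has_vector_derivative_mult of_real_powr_has_vector_derivative dQ) (use t in simp)
  then have dm: "(mext z has_vector_derivative
      of_real t powr (z - 1) * (0 - (z - 1) * mkernel z t)
        + (z - 1) / of_real t * of_real t powr (z - 1) * Q t) (at t)"
    by (rule has_vector_derivative_transform_within_open[where S = "{1<..}"])
       (use t in \<open>auto simp: m_eq\<close>)
  have ker: "of_real t powr (z - 1) * mkernel z t = mext z (t - 1) / of_real t"
    using t by (simp add: mkernel_def powr_diff)
  have "of_real t powr (z - 1) * (0 - (z - 1) * mkernel z t)
        + (z - 1) / of_real t * of_real t powr (z - 1) * Q t =
      (z - 1) * (of_real t powr (z - 1) * Q t) / of_real t - (z - 1) * (mext z (t - 1) / of_real t)"
    by (simp only: flip: ker) (simp add: algebra_simps)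
  then show ?thesis
    using t dm by (simp add: m_eq right_diff_distrib)
qed

end

section \<open>Bounds uniform in z over the half-disc\<close>

lemma norm_of_real_powr: "t > 0 \<Longrightarrow> norm (of_real t powr (w::complex)) = t powr Re w"
  by (simp add: norm_powr_real_powr)

text \<open>\<open>g1\<close> is \<open>ell\<close> divided by an exponential, hence continuous on
  the whole closed disc, which is compact and contains the edge \<open>Re z = 0\<close>.\<close>

lemma g1_bounded: "\<exists>G\<ge>0. \<forall>z. norm z \<le> R \<longrightarrow> norm (g1 z) \<le> G"
proof -
  have "g1 z = ell z / exp ((z - 1) * euler_mascheroni)" for z
    by (simp add: ell_eq_g1)
  then have g1: "g1 = (\<lambda>z. ell z / exp ((z - 1) * euler_mascheroni))" by blast
  have "continuous_on (cball 0 R) ell"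
    using ell_analytic holomorphic_on_imp_continuous_on analytic_imp_holomorphic continuous_on_subset by blast
  then have "continuous_on (cball 0 R) g1"
    unfolding g1 by (intro continuous_intros) auto
  then have "bounded (g1 ` cball 0 R)"
    by (intro compact_imp_bounded compact_continuous_image) auto
  then obtain G where "G > 0" "\<forall>w\<in>g1 ` cball 0 R. norm w \<le> G" using bounded_pos by metis
  then show ?thesis by (intro exI[of _ G]) auto
qed

lemma rGamma_bounded: "\<exists>G\<ge>0. \<forall>z::complex. norm z \<le> R \<longrightarrow> norm (rGamma (z + 1)) \<le> G"
proof -
  have "bounded ((\<lambda>z::complex. rGamma (z + 1)) ` cball 0 R)"
    by (intro compact_imp_bounded compact_continuous_image holomorphic_on_imp_continuous_on)
       (auto intro!: holomorphic_intros)
  then obtain G where "G > 0" "\<forall>w\<in>(\<lambda>z::complex. rGamma (z + 1)) ` cball 0 R. norm w \<le> G" using bounded_pos by metis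
  then show ?thesis by (intro exI[of _ G]) auto
qed

lemma mkernel_mcoeff_bounded:
  assumes "R > 0"
  shows "\<exists>G\<ge>0. \<forall>z. Re z > 0 \<and> norm z \<le> R \<longrightarrow>
     norm (mcoeff z) \<le> G \<and> (\<forall>t\<in>{1..2}. norm (integral {1..t} (mkernel z)) \<le> G)"
proof -
  obtain G1 where G1: "G1 \<ge> 0" "\<And>z. norm z \<le> R \<Longrightarrow> norm (g1 z) \<le> G1"
    using g1_bounded by blast
  obtain G2 where G2: "G2 \<ge> 0" "\<And>z::complex. norm z \<le> R \<Longrightarrow> norm (rGamma (z + 1)) \<le> G2"
    using rGamma_bounded by blast
  \<comment> \<open>\<open>R\<close> allows for the factor z in 1 / Gamma(z) = z rGamma(z + 1). The
    3 is 2 + 1: t P(t) is at most 2 in modulus and the integral of P at most 1.\<close>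
  define G where "G = G1 * G2 * (R + 3)"
  have "norm (mcoeff z) \<le> G \<and> (\<forall>t\<in>{1..2}. norm (integral {1..t} (mkernel z)) \<le> G)"
    if z: "Re z > 0" "norm z \<le> R" for z
  proof (intro conjI ballI)
    have "mcoeff z = g1 z * rGamma (z + 1) * z"
      by (metis mcoeff_def divide_inverse rGamma_inverse_Gamma rGamma_plus1 mult.assoc mult.commute)
    then have "norm (mcoeff z) = norm (g1 z) * norm (rGamma (z + 1)) * norm z"
      by (simp add: norm_mult)
    also have "\<dots> \<le> G1 * G2 * (R + 3)"
      using G1 G2 z by (intro mult_mono) (auto simp: add_increasing2)
    finally show "norm (mcoeff z) \<le> G" by (simp add: G_def)
  next
    fix t :: real assume t: "t \<in> {1..2}"
    define P where "P = (\<lambda>u::real. complex_of_real ((u - 1) / u) powr z)"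
    have P: "norm (P u) \<le> 1" if "u \<ge> 1" for u
      unfolding P_def by (rule norm_ratio_powr_le[OF z(1) that])
    have "norm (integral {1..t} P) \<le> 1 * (t - 1)"
      by (rule integral_bound) (use t P continuous_on_ratio_powr[OF z(1)] in \<open>auto simp: P_def\<close>)
    moreover have "norm (of_real t * P t) \<le> 2 * 1"
      unfolding norm_mult using t P[of t] by (intro mult_mono) auto
    ultimately have "norm (of_real t * P t - integral {1..t} P) \<le> R + 3"
      using norm_triangle_ineq4[of "of_real t * P t" "integral {1..t} P"] t assms by simp
    moreover have "integral {1..t} (mkernel z) = g1 z * rGamma (z + 1) * (of_real t * P t - integral {1..t} P)"
      using has_integral_mkernel[OF z(1), of t] t by (simp add: P_def integral_unique)
    ultimately show "norm (integral {1..t} (mkernel z)) \<le> G"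
      using G1 G2 z by (simp add: norm_mult G_def mult_mono)
  qed
  moreover have "G \<ge> 0" using G1 G2 assms by (simp add: G_def)
  ultimately show ?thesis by blast
qed

lemma mfun_bounded:
  assumes "R > 0"
  shows "\<exists>B\<ge>0. \<forall>z. Re z > 0 \<and> norm z \<le> R \<longrightarrow> (\<forall>t\<in>{1..real n + 2}. norm (mfun z t) \<le> B)"
proof (induction n)
  obtain G where G: "G \<ge> 0" "\<And>z. Re z > 0 \<Longrightarrow> norm z \<le> R \<Longrightarrow> norm (mcoeff z) \<le> G"
      "\<And>z t. Re z > 0 \<Longrightarrow> norm z \<le> R \<Longrightarrow> t \<in> {1..2} \<Longrightarrow> norm (integral {1..t} (mkernel z)) \<le> G"
    using mkernel_mcoeff_bounded[OF assms] by blast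
  have main: "norm (mfun z t) \<le> b powr (R + 1) * (G + (R + 1) * D)"
    if "Re z > 0" "norm z \<le> R" "t \<in> {1..b}" "norm (integral {1..t} (mkernel z)) \<le> D" "D \<ge> 0" for z t b D
  proof -
    have "norm (of_real t powr (z - 1)) = t powr (Re z - 1)"
      using that by (simp add: norm_of_real_powr)
    also have "\<dots> \<le> t powr (R + 1)"
      using that abs_Re_le_cmod[of z] by (intro powr_mono) auto
    also have "\<dots> \<le> b powr (R + 1)"
      using that assms by (intro powr_mono2) auto
    finally have 1: "norm (of_real t powr (z - 1)) \<le> b powr (R + 1)" .
    have "norm (z - 1) \<le> R + 1" using that norm_triangle_ineq4[of z 1] by simp
    then have "norm ((z - 1) * integral {1..t} (mkernel z)) \<le> (R + 1) * D"
      unfolding norm_mult using that assms by (intro mult_mono) auto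
    then have "norm (mcoeff z - (z - 1) * integral {1..t} (mkernel z)) \<le> G + (R + 1) * D"
      using G(2)[OF that(1,2)] norm_triangle_ineq4[of "mcoeff z" "(z - 1) * integral {1..t} (mkernel z)"] by linarith
    then show ?thesis
      using that mfun_eq[OF that(1), of t] 1 by (simp add: norm_mult mult_mono)
  qed
  {
    case 0
    show ?case
      using main[where D = G and b = 2] G assms by (intro exI[of _ "2 powr (R + 1) * (G + (R + 1) * G)"]) auto
  next
    case (Suc n)
    then obtain B where B: "B \<ge> 0" "\<And>z t. Re z > 0 \<Longrightarrow> norm z \<le> R \<Longrightarrow> t \<in> {1..real n + 2} \<Longrightarrow> norm (mfun z t) \<le> B"
      by blast
    \<comment> \<open>\<open>G\<close> accounts for [1, 2]; on [2, t], of length at most n + 1, the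
      kernel is at most \<open>B\<close> because u^z has modulus at least 1.\<close>
    define D where "D = G + B * (real n + 1)"
    have D: "D \<ge> 0" using G B by (simp add: D_def)
    have "norm (integral {1..t} (mkernel z)) \<le> D" if z: "Re z > 0" "norm z \<le> R" and t: "t \<in> {1..real (Suc n) + 2}" for z t
    proof (cases "t \<le> 2")
      case True
      then show ?thesis using G(3)[OF z, of t] t B by (simp add: D_def add_increasing2)
    next
      case False
      have int: "mkernel z integrable_on {1..t}" by (rule mkernel_integrable[OF z(1)])
      have "norm (integral {2..t} (mkernel z)) \<le> B * measure lborel {2..t}"
      proof (rule has_integral_bound_real[of B "{}" "mkernel z"])
        show "(mkernel z has_integral integral {2..t} (mkernel z)) {2..t}"
          using int by (intro integrable_integral integrable_on_subinterval[OF int]) auto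
        fix u assume "u \<in> {2..t} - {}"
        then have u: "2 \<le> u" "u \<le> t" by auto
        have "norm (mfun z (u - 1)) \<le> B" using B(2)[OF z, of "u - 1"] u t by auto
        moreover have "norm (of_real u powr z) \<ge> 1"
          using u z by (simp add: norm_of_real_powr ge_one_powr_ge_zero)
        ultimately show "norm (mkernel z u) \<le> B"
          using u z B(1) frac_le[of B "norm (mfun z (u - 1))" 1 "norm (of_real u powr z)"]
          by (simp add: mkernel_def mext_eq_mfun norm_divide)
      qed (use False B in auto)
      also have "\<dots> \<le> B * (real n + 1)" using t B(1) False by (intro mult_left_mono) auto
      finally have "norm (integral {2..t} (mkernel z)) \<le> B * (real n + 1)" .
      moreover have "integral {1..2} (mkernel z) + integral {2..t} (mkernel z) = integral {1..t} (mkernel z)"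
        by (rule Henstock_Kurzweil_Integration.integral_combine) (use False int in auto)
      moreover have "norm (integral {1..2} (mkernel z)) \<le> G" using G(3)[OF z, of 2] by simp
      ultimately show ?thesis
        unfolding D_def using norm_triangle_ineq[of "integral {1..2} (mkernel z)" "integral {2..t} (mkernel z)"] by simp
    qed
    then show ?case
      using main[where D = D and b = "real (Suc n) + 2"] D G assms
      by (intro exI[of _ "(real (Suc n) + 2) powr (R + 1) * (G + (R + 1) * D)"]) auto
  }
qed

section \<open>Convergence to a limit\<close>

lemma norm_diff_le_derivative_bound:
  fixes m :: "real \<Rightarrow> 'a::real_normed_vector"
  assumes "\<And>t. t \<in> {x..y} \<Longrightarrow> (m has_vector_derivative h t) (at t)"
    and "\<And>t. t \<in> {x..y} \<Longrightarrow> norm (h t) \<le> b" and "x \<le> y"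
  shows "norm (m y - m x) \<le> b * (y - x)"
proof -
  have "norm (m y - m x) \<le> b * norm (y - x)"
  proof (rule differentiable_bound[of "{x..y}"])
    show "(m has_derivative (\<lambda>u. u *\<^sub>R h t)) (at t within {x..y})" if "t \<in> {x..y}" for t
      using assms(1)[OF that] by (auto simp: has_vector_derivative_def intro: has_derivative_at_withinI)
    show "onorm (\<lambda>u. u *\<^sub>R h t) \<le> b" if "t \<in> {x..y}" for t
      using assms(2)[OF that] by (intro onorm_le) (metis mult.commute mult_right_mono norm_scaleR norm_ge_zero real_norm_def)
  qed (use assms in auto)
  then show ?thesis using assms(3) by simp
qed

text \<open>The rate will depend only on \<open>A\<close>, \<open>B\<close> and \<open>N\<close>,
  not on \<open>m\<close> or \<open>a\<close>; this carries the uniformity in \<open>z\<close>. From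
  \<open>N\<close> on the factor A / n is at most 1/2, and \<open>B\<close> controls the start of
  the induction.\<close>

locale delay_equation =
  fixes m :: "real \<Rightarrow> complex" and a :: complex and A B :: real and N :: nat
  assumes deriv: "\<And>t. t \<ge> real N \<Longrightarrow>
      (m has_vector_derivative a / of_real t * (m t - m (t - 1))) (at t)"
    and cont: "continuous_on {real N - 1..} m"
    and a_le: "norm a \<le> A" and A_pos: "A > 0" and N_ge: "2 * A \<le> real N"
    and bound: "\<And>t. t \<in> {real N - 1..real N + 1} \<Longrightarrow> norm (m t) \<le> B"
begin

text \<open>Normalised so that \<open>rate N = 2 * B\<close>, the bound for the first slopes; each
  further unit step contributes a factor A / (n + 1).\<close>

definition rate :: "nat \<Rightarrow> real" where
  "rate n = 2 * B * (fact N / A ^ N) * (A ^ n / fact n)"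

lemma B_nonneg: "B \<ge> 0"
  using bound[of "real N"] order_trans[OF norm_ge_zero] by fastforce

lemma rate_nonneg: "rate n \<ge> 0"
  using B_nonneg A_pos by (simp add: rate_def)

lemma rate_Suc: "rate (Suc n) = A / real (Suc n) * rate n"
  by (simp add: rate_def divide_simps)

lemma rate_Suc_le:
  assumes "n \<ge> N"
  shows "rate (Suc n) \<le> rate n / 2"
proof -
  have "A / real (Suc n) \<le> 1 / 2" using N_ge assms A_pos by (simp add: field_simps)
  then have "A / real (Suc n) * rate n \<le> 1 / 2 * rate n" by (intro mult_right_mono rate_nonneg)
  then show ?thesis by (simp add: rate_Suc)
qed

lemma rate_LIMSEQ: "rate \<longlonglongrightarrow> 0"
proof -
  have "summable (\<lambda>n. A ^ n / fact n)"
    using summable_exp[of A] by (simp add: field_simps)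
  from tendsto_mult_right_zero[OF summable_LIMSEQ_zero[OF this]]
  show ?thesis unfolding rate_def[abs_def] .
qed

definition slope :: "real \<Rightarrow> complex" where
  "slope t = a / of_real t * (m t - m (t - 1))"

lemma N_pos: "real N > 0"
  using N_ge A_pos by linarith

lemma norm_slope_le:
  assumes "t \<ge> real n" "n > 0"
  shows "norm (slope t) \<le> A / real n * norm (m t - m (t - 1))"
proof -
  have "norm a / t \<le> A / real n" using assms a_le A_pos by (intro frac_le) auto
  then show ?thesis
    using mult_right_mono[of "norm a / t" "A / real n" "norm (m t - m (t - 1))"] assms
    by (simp add: slope_def norm_mult norm_divide)
qed

text \<open>
  On \<open>[n, n + 1]\<close> the slope is at most \<open>A / n\<close> times the variation of \<open>m\<close> over a unit interval;
  where it is maximal, that variation cannot be due to \<open>[n, n + 1]\<close> itself because \<open>A / n \<le> 1 / 2\<close>.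
\<close>

lemma norm_slope_le_rate: "t \<in> {real (N + k)..real (N + k) + 1} \<Longrightarrow> norm (slope t) \<le> rate (N + k)"
proof (induction k arbitrary: t)
  case 0
  have "norm (m t - m (t - 1)) \<le> B + B"
    using 0 bound[of t] bound[of "t - 1"] norm_triangle_ineq4[of "m t" "m (t - 1)"] by auto
  moreover have "A / real N \<le> 1" using N_ge N_pos A_pos by simp
  ultimately have "A / real N * norm (m t - m (t - 1)) \<le> 1 * (B + B)"
    using A_pos by (intro mult_mono) auto
  moreover have "rate N = 2 * B" using A_pos by (simp add: rate_def)
  ultimately show ?case using norm_slope_le[of N t] N_pos 0 by simp
next
  case (Suc k)
  define n where "n = N + Suc k"
  have n: "n > 0" "n \<ge> N" "real n - 1 = real (N + k)" by (auto simp: n_def)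
  have "continuous_on {real n..real n + 1} slope"
    unfolding slope_def
    by (intro continuous_intros continuous_on_subset[OF cont] continuous_on_compose2[OF cont, of _ "\<lambda>t. t - 1"])
       (use n N_pos in auto)
  then have "continuous_on {real n..real n + 1} (\<lambda>t. norm (slope t))"
    by (rule continuous_on_norm)
  from continuous_attains_sup[OF _ _ this] obtain s
    where s: "s \<in> {real n..real n + 1}" and max: "\<And>t. t \<in> {real n..real n + 1} \<Longrightarrow> norm (slope t) \<le> norm (slope s)"
    by auto
  \<comment> \<open>[s - 1, s] is covered by [n - 1, n], where the induction hypothesis applies, and
    [n, n + 1], where \<open>s\<close> is the maximum point.\<close>
  let ?b = "max (rate (N + k)) (norm (slope s))"
  have "norm (slope u) \<le> ?b" if "u \<in> {s - 1..s}" for u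
  proof (cases "u \<ge> real n")
    case True
    then show ?thesis using max[of u] that s by (simp add: max.coboundedI2)
  next
    case False
    then show ?thesis using Suc.IH[of u] that s n by (intro max.coboundedI1) auto
  qed
  moreover have "(m has_vector_derivative slope u) (at u)" if "u \<in> {s - 1..s}" for u
    unfolding slope_def using that s n by (intro deriv) (auto simp: n_def)
  ultimately have "norm (m s - m (s - 1)) \<le> ?b * (s - (s - 1))"
    by (intro norm_diff_le_derivative_bound) auto
  then have "A / real n * norm (m s - m (s - 1)) \<le> A / real n * ?b"
    using A_pos n by (intro mult_left_mono) auto
  then have le: "norm (slope s) \<le> A / real n * ?b"
    using norm_slope_le[of n s] s n by simp
  have "norm (slope s) \<le> rate (N + k)"
  proof (rule ccontr)
    assume "\<not> ?thesis"
    then have gt: "norm (slope s) > rate (N + k)" and b: "?b = norm (slope s)" by auto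
    have "A / real n \<le> 1 / 2" using N_ge n A_pos by (simp add: field_simps)
    then have "A / real n * norm (slope s) \<le> 1 / 2 * norm (slope s)" by (intro mult_right_mono) auto
    then have "norm (slope s) \<le> 0" using le unfolding b by linarith
    then show False using gt rate_nonneg[of "N + k"] by linarith
  qed
  then have "norm (slope s) \<le> A / real n * rate (N + k)" using le by (simp add: max_def)
  then have "norm (slope s) \<le> rate n" using rate_Suc[of "N + k"] by (simp add: n_def)
  then show ?case using max[of t] Suc.prems unfolding n_def by (simp only: n_def) simp
qed

lemma norm_diff_unit_le_rate:
  assumes "n \<ge> N" "real n \<le> s" "s \<le> t" "t \<le> real n + 1"
  shows "norm (m t - m s) \<le> rate n"
proof -
  have "norm (slope u) \<le> rate n" if "u \<in> {s..t}" for u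
    using norm_slope_le_rate[of u "n - N"] that assms by auto
  moreover have "(m has_vector_derivative slope u) (at u)" if "u \<in> {s..t}" for u
    unfolding slope_def using that assms by (intro deriv) auto
  ultimately have "norm (m t - m s) \<le> rate n * (t - s)"
    using assms by (intro norm_diff_le_derivative_bound) auto
  also have "\<dots> \<le> rate n * 1" using assms by (intro mult_left_mono rate_nonneg) auto
  finally show ?thesis by simp
qed

text \<open>A geometric series in disguise: reaching the next integer costs \<open>rate n\<close>,
  and all the rest costs \<open>2 * rate (Suc n)\<close>, which is again at most
  \<open>rate n\<close>.\<close>

lemma norm_diff_le_rate_aux:
  "n \<ge> N \<Longrightarrow> real n \<le> s \<Longrightarrow> s \<le> t \<Longrightarrow> t \<le> real n + real j \<Longrightarrow> norm (m t - m s) \<le> 2 * rate n"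
proof (induction j arbitrary: n s)
  case 0
  then have "t = s" by simp
  then show ?case using rate_nonneg[of n] by simp
next
  case (Suc j)
  have half: "2 * rate (Suc n) \<le> rate n" using rate_Suc_le[OF Suc.prems(1)] by simp
  show ?case
  proof (cases "s \<ge> real (Suc n)")
    case True
    then have "norm (m t - m s) \<le> 2 * rate (Suc n)" using Suc.prems by (intro Suc.IH) auto
    then show ?thesis using half rate_nonneg[of n] by linarith
  next
    case False
    show ?thesis
    proof (cases "t \<le> real (Suc n)")
      case True
      then show ?thesis using norm_diff_unit_le_rate[of n s t] Suc.prems rate_nonneg[of n] by simp
    next
      case t: False
      have "norm (m t - m (real (Suc n))) \<le> 2 * rate (Suc n)"
        using Suc.prems t by (intro Suc.IH) auto
      moreover have "norm (m (real (Suc n)) - m s) \<le> rate n"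
        using Suc.prems False by (intro norm_diff_unit_le_rate) auto
      ultimately show ?thesis
        using half norm_triangle_ineq[of "m t - m (real (Suc n))" "m (real (Suc n)) - m s"] by simp
    qed
  qed
qed

lemma norm_diff_le_rate:
  assumes "n \<ge> N" "real n \<le> s" "s \<le> t"
  shows "norm (m t - m s) \<le> 2 * rate n"
proof -
  obtain j where "t \<le> real j" using real_arch_simple by blast
  then show ?thesis using assms by (intro norm_diff_le_rate_aux[of n s t j]) auto
qed

text \<open>The values at integers form a Cauchy sequence; letting the later argument run through
  the integers in the difference bound gives the rate at every real \<open>s\<close>.\<close>

lemma limit_exists: "\<exists>L. \<forall>n\<ge>N. \<forall>s\<ge>real n. norm (m s - L) \<le> 2 * rate n"
proof -
  have "Cauchy (\<lambda>k. m (real k))"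
  proof (rule metric_CauchyI)
    fix e :: real assume "e > 0"
    then have "\<forall>\<^sub>F n in sequentially. rate n < e / 4"
      using order_tendstoD(2)[OF rate_LIMSEQ, of "e / 4"] by simp
    then have "\<forall>\<^sub>F n in sequentially. rate n < e / 4 \<and> n \<ge> N"
      by (intro eventually_conj eventually_ge_at_top)
    then obtain n where n: "rate n < e / 4" "n \<ge> N"
      by (auto simp: eventually_sequentially)
    have "dist (m (real i)) (m (real j)) < e" if "i \<ge> n" "j \<ge> n" for i j
      using norm_diff_le_rate[OF n(2), of "real n" "real i"] norm_diff_le_rate[OF n(2), of "real n" "real j"]
        norm_triangle_ineq4[of "m (real i) - m (real n)" "m (real j) - m (real n)"] that n
      by (simp add: dist_norm)
    then show "\<exists>M. \<forall>i\<ge>M. \<forall>j\<ge>M. dist (m (real i)) (m (real j)) < e" by blast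
  qed
  then obtain L where L: "(\<lambda>k. m (real k)) \<longlonglongrightarrow> L"
    using Cauchy_convergent_iff convergent_def by blast
  have "norm (m s - L) \<le> 2 * rate n" if "n \<ge> N" "s \<ge> real n" for n s
  proof (rule tendsto_upperbound)
    show "((\<lambda>k. norm (m s - m (real k))) \<longlongrightarrow> norm (m s - L)) sequentially"
      by (intro tendsto_intros L)
    obtain j where j: "s \<le> real j" using real_arch_simple by blast
    show "\<forall>\<^sub>F k in sequentially. norm (m s - m (real k)) \<le> 2 * rate n"
      using eventually_ge_at_top[of j]
    proof eventually_elim
      case (elim k)
      then show ?case
        using norm_diff_le_rate[OF that, of "real k"] j by (simp add: norm_minus_commute)
    qed
  qed simp
  then show ?thesis by blast
qed

end

text \<open>A crude Stirling bound: s^n / n! is one term of the series of exp s, and n \<ge> s - 1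
  turns s^n into exp((s - 1) ln s). The 2 collects s from exp s and another s absorbing the surplus
  ln s.\<close>

lemma power_over_fact_le_exp:
  fixes A s :: real
  assumes "A \<ge> 1" "s \<ge> 1" "n = nat \<lfloor>s\<rfloor>"
  shows "A ^ n / fact n \<le> exp (- s * ln s + (ln A + 2) * s)"
proof -
  have n: "real n \<le> s" "s \<le> real n + 1" using assms by (auto simp: of_nat_floor)
  have "s ^ n / fact n \<le> exp s"
  proof -
    have "(\<Sum>k\<in>{n}. s ^ k /\<^sub>R fact k) \<le> (\<Sum>k. s ^ k /\<^sub>R fact k)"
      using assms by (intro sum_le_suminf summable_exp_generic) auto
    then show ?thesis by (simp add: exp_def divide_inverse mult.commute)
  qed
  then have "1 / fact n \<le> exp s / s ^ n"
    using assms by (simp add: field_simps)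
  also have "\<dots> \<le> exp s / exp ((s - 1) * ln s)"
  proof -
    have "(s - 1) * ln s \<le> real n * ln s" using n assms by (intro mult_right_mono) auto
    then have "exp ((s - 1) * ln s) \<le> s ^ n"
      using assms by (metis exp_le_cancel_iff exp_of_nat_mult exp_ln less_le_trans zero_less_one)
    then show ?thesis using assms by (intro divide_left_mono) auto
  qed
  also have "\<dots> = exp (s - (s - 1) * ln s)" by (simp add: exp_diff)
  finally have 1: "1 / fact n \<le> exp (s - (s - 1) * ln s)" .
  have "A ^ n = exp (real n * ln A)"
    using assms(1) exp_of_nat_mult[of n "ln A"] by simp
  also have "\<dots> \<le> exp (s * ln A)"
    using n assms by (auto intro: mult_right_mono)
  finally have "A ^ n * (1 / fact n) \<le> exp (s * ln A) * exp (s - (s - 1) * ln s)"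
    using 1 by (intro mult_mono) auto
  also have "\<dots> = exp (s * ln A + s - s * ln s + ln s)"
    by (simp add: exp_add[symmetric] algebra_simps)
  also have "\<dots> \<le> exp (- s * ln s + (ln A + 2) * s)"
    using ln_le_minus_one[of s] assms by (simp add: algebra_simps)
  finally show ?thesis by simp
qed

lemma mfun_delay_equation:
  assumes "R > 0" "N \<ge> 3" "2 * (R + 1) \<le> real N" "Re z > 0" "norm z \<le> R"
    and "\<And>t. t \<in> {1..real N + 2} \<Longrightarrow> norm (mfun z t) \<le> B"
  shows "delay_equation (mext z) (z - 1) (R + 1) B N"
proof
  show "norm (z - 1) \<le> R + 1"
    using assms norm_triangle_ineq4[of z 1] by simp
  show "continuous_on {real N - 1..} (mext z)"
    by (rule continuous_on_subset[OF continuous_on_mext[OF assms(4)]]) (use assms(2) in auto)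
  show "(mext z has_vector_derivative (z - 1) / of_real t * (mext z t - mext z (t - 1))) (at t)"
    if "t \<ge> real N" for t
    using that assms(2) by (intro mext_has_vector_derivative assms) auto
  show "norm (mext z t) \<le> B" if "t \<in> {real N - 1..real N + 1}" for t
    using that assms by (subst mext_eq_mfun) auto
qed (use assms in auto)

lemma mfun_limit_rate:
  assumes "R > 0"
  shows "\<exists>C \<alpha>0. \<alpha>0 \<ge> 1 \<and> (\<forall>z. Re z > 0 \<and> norm z \<le> R \<longrightarrow>
     (\<exists>L. \<forall>\<alpha>\<ge>\<alpha>0. norm (mext z \<alpha> - L) \<le> exp (- \<alpha> * ln \<alpha> + C * \<alpha>)))"
proof -
  obtain N where N: "N \<ge> 3" "2 * (R + 1) \<le> real N"
  proof
    show "nat \<lceil>2 * (R + 1)\<rceil> + 3 \<ge> 3" by simp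
    show "2 * (R + 1) \<le> real (nat \<lceil>2 * (R + 1)\<rceil> + 3)" by linarith
  qed
  obtain B where B: "B \<ge> 0" "\<And>z t. Re z > 0 \<Longrightarrow> norm z \<le> R \<Longrightarrow> t \<in> {1..real N + 2} \<Longrightarrow> norm (mfun z t) \<le> B"
    using mfun_bounded[OF assms, of N] by blast
  define D where "D = 2 * (2 * B * (fact N / (R + 1) ^ N))"
  have D: "D \<ge> 0" using B assms by (simp add: D_def)
  have "\<exists>L. \<forall>\<alpha>\<ge>real N. norm (mext z \<alpha> - L) \<le> exp (- \<alpha> * ln \<alpha> + (ln (R + 1) + 2 + D) * \<alpha>)"
    if z: "Re z > 0" "norm z \<le> R" for z
  proof -
    interpret delay_equation "mext z" "z - 1" "R + 1" B N
      using mfun_delay_equation[OF assms N z] B(2)[OF z] by blast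
    obtain L where L: "\<And>n s. n \<ge> N \<Longrightarrow> s \<ge> real n \<Longrightarrow> norm (mext z s - L) \<le> 2 * rate n"
      using limit_exists by blast
    have "norm (mext z s - L) \<le> exp (- s * ln s + (ln (R + 1) + 2 + D) * s)" if s: "s \<ge> real N" for s
    proof -
      define n where "n = nat \<lfloor>s\<rfloor>"
      have s1: "s \<ge> 1" using s N by simp
      have "n \<ge> N" "real n \<le> s" using s s1 by (auto simp: n_def le_nat_floor of_nat_floor)
      then have "norm (mext z s - L) \<le> D * ((R + 1) ^ n / fact n)"
        using L[of n s] by (simp add: rate_def D_def)
      also have "\<dots> \<le> exp (D * s) * exp (- s * ln s + (ln (R + 1) + 2) * s)"
      proof (intro mult_mono)
        \<comment> \<open>The multiplicative constant moves into the exponent, where it becomes part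
          of \<open>C\<close>.\<close>
        have "D \<le> D * s" using D s1 by (simp add: mult_le_cancel_left1)
        then show "D \<le> exp (D * s)" using exp_ge_add_one_self[of "D * s"] by linarith
        show "(R + 1) ^ n / fact n \<le> exp (- s * ln s + (ln (R + 1) + 2) * s)"
          by (rule power_over_fact_le_exp) (use assms s1 n_def in auto)
      qed (use assms in auto)
      also have "\<dots> = exp (- s * ln s + (ln (R + 1) + 2 + D) * s)"
        by (simp add: exp_add[symmetric] algebra_simps)
      finally show ?thesis .
    qed
    then show ?thesis by blast
  qed
  then show ?thesis using N by (intro exI[of _ "ln (R + 1) + 2 + D"] exI[of _ "real N"]) auto
qed

section \<open>The limit\<close>

lemma abs_exp_diff_le:
  fixes x y t b :: real
  assumes "x \<ge> b" "y \<ge> b" "t \<ge> 0"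
  shows "\<bar>exp (- (x * t)) - exp (- (y * t))\<bar> \<le> \<bar>x - y\<bar> * (t * exp (- (b * t)))"
proof -
  have *: "\<bar>exp (- (x * t)) - exp (- (y * t))\<bar> \<le> \<bar>x - y\<bar> * (t * exp (- (b * t)))"
    if xy: "x \<le> y" and b: "b \<le> x" for x y
  proof -
    have "1 - exp (- ((y - x) * t)) \<le> (y - x) * t"
      using exp_ge_add_one_self[of "- ((y - x) * t)"] by linarith
    moreover have "exp (- ((y - x) * t)) \<le> 1" using xy assms(3) by simp
    moreover have "exp (- (x * t)) \<le> exp (- (b * t))" using b assms(3) by (simp add: mult_right_mono)
    ultimately have "exp (- (x * t)) * (1 - exp (- ((y - x) * t))) \<le> exp (- (b * t)) * ((y - x) * t)"
      by (intro mult_mono) auto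
    moreover have "exp (- (x * t)) * (1 - exp (- ((y - x) * t))) = exp (- (x * t)) - exp (- (y * t))"
      by (simp add: right_diff_distrib exp_add[symmetric] algebra_simps)
    moreover have "exp (- (y * t)) \<le> exp (- (x * t))" using xy assms(3) by (simp add: mult_right_mono)
    ultimately show ?thesis using xy by (simp add: mult_ac)
  qed
  show ?thesis
    using *[of x y] *[of y x] assms by (cases "x \<le> y") (auto simp: abs_minus_commute)
qed

text \<open>A factor t is traded for half of the exponential decay, so that every weight below fits
  the same family of dominating functions.\<close>

lemma mult_exp_minus_le:
  fixes s t :: real
  assumes "s > 0"
  shows "t * exp (- (s * t)) \<le> 2 / s * exp (- (s / 2 * t))"
proof -
  have "s / 2 * t \<le> exp (s / 2 * t)" using exp_ge_add_one_self[of "s / 2 * t"] by linarith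
  then have "t \<le> 2 / s * exp (s / 2 * t)" using assms by (simp add: field_simps)
  then have "t * exp (- (s * t)) \<le> 2 / s * exp (s / 2 * t) * exp (- (s * t))"
    by (intro mult_right_mono) auto
  also have "\<dots> = 2 / s * exp (- (s / 2 * t))"
    by (simp add: exp_add[symmetric] mult.assoc)
  finally show ?thesis .
qed

lemma integrable_Gamma_lborel:
  assumes "Re z > 0" "b > 0"
  shows "integrable lborel (\<lambda>t. indicator {0<..} t *\<^sub>R (of_real t powr (z - 1) / of_real (exp (b * t)) :: complex))"
proof -
  have "integrable lebesgue (\<lambda>t. indicator {0<..} t *\<^sub>R (of_real t powr (z - 1) / of_real (exp (b * t)) :: complex))"
    using absolutely_integrable_Gamma_integral[OF assms] by (simp add: set_integrable_def)
  moreover have "(\<lambda>t. indicator {0<..} t *\<^sub>R (of_real t powr (z - 1) / of_real (exp (b * t)) :: complex)) \<in> borel_measurable borel"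
    by (rule borel_measurable_continuous_on_indicator) (auto intro!: continuous_intros continuous_on_of_real_powr)
  ultimately show ?thesis by (simp add: integrable_completion)
qed

lemma integral_Gamma_lborel:
  assumes "Re z > 0"
  shows "(\<integral>t. indicator {0<..} t *\<^sub>R (of_real (exp (- t)) * of_real t powr (z - 1)) \<partial>lborel) = Gamma z"
proof -
  let ?f = "\<lambda>t. complex_of_real t powr (z - 1) / of_real (exp (1 * t))"
  have restrict: "(f has_integral I) {0<..}" if "((\<lambda>t. indicator {0<..} t *\<^sub>R f t) has_integral I) UNIV"
    for f :: "real \<Rightarrow> complex" and I
  proof -
    have "(\<lambda>t. indicator {0<..} t *\<^sub>R f t) = (\<lambda>t. if t \<in> {0<..} then f t else 0)"
      by (auto simp: fun_eq_iff)
    then show ?thesis using that has_integral_restrict_UNIV[of "{0<..}" f I] by simp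
  qed
  have "(?f has_integral (\<integral>t. indicator {0<..} t *\<^sub>R ?f t \<partial>lborel)) {0<..}"
    by (intro restrict has_integral_integral_lborel integrable_Gamma_lborel assms zero_less_one)
  moreover have "(?f has_integral Gamma z) {0<..}"
    using Gamma_integral_complex'[OF assms] by simp
  ultimately have "(\<integral>t. indicator {0<..} t *\<^sub>R ?f t \<partial>lborel) = Gamma z"
    by (rule has_integral_unique)
  moreover have "?f t = of_real (exp (- t)) * of_real t powr (z - 1)" for t
    by (simp add: exp_minus divide_inverse)
  ultimately show ?thesis by (simp only:)
qed

text \<open>The common majorant for the dominated convergence arguments below that pass to the limit
  in a Laplace integral or its difference quotient: 1 stands for the bounded part of m, the power
  for its singularity at 0.\<close>

lemma integrable_exp_powr_dominator:
  fixes r b :: real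
  assumes "r > -1" "b > 0"
  shows "integrable lborel (\<lambda>t. indicator {0<..} t * (exp (- (b * t)) * (1 + t powr r)))"
proof -
  have *: "integrable lborel (\<lambda>t. indicator {0<..} t * (exp (- (b * t)) * t powr q))" if "q > -1" for q
  proof -
    have "integrable lborel (\<lambda>t. norm (indicator {0<..} t *\<^sub>R (of_real t powr (of_real (q + 1) - 1) / of_real (exp (b * t)) :: complex)))"
      by (intro integrable_norm integrable_Gamma_lborel) (use that assms in auto)
    also have "(\<lambda>t. norm (indicator {0<..} t *\<^sub>R (of_real t powr (of_real (q + 1) - 1) / of_real (exp (b * t)) :: complex)))
        = (\<lambda>t. indicator {0<..} t * (exp (- (b * t)) * t powr q))"
      by (auto simp: fun_eq_iff indicator_def norm_divide norm_mult norm_of_real_powr exp_minus field_simps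
            simp del: of_real_exp)
    finally show ?thesis .
  qed
  have "integrable lborel (\<lambda>t. indicator {0<..} t * (exp (- (b * t)) * t powr 0) + indicator {0<..} t * (exp (- (b * t)) * t powr r))"
    using assms by (intro Bochner_Integration.integrable_add *) auto
  also have "(\<lambda>t. indicator {0<..} t * (exp (- (b * t)) * t powr 0) + indicator {0<..} t * (exp (- (b * t)) * t powr r))
      = (\<lambda>t. indicator {0<..} t * (exp (- (b * t)) * (1 + t powr r)))"
    by (auto simp: fun_eq_iff indicator_def algebra_simps)
  finally show ?thesis .
qed

text \<open>
  The delay equation gives the Laplace transform \<open>Lap\<close> of \<open>mext z\<close> a linear differential equation of
  first order: \<open>exp ((z - 1) * Ein s) * s * Lap s\<close> is constant. Its limit as \<open>s\<close> tends to 0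
  is the limit of \<open>mext z\<close> at infinity; as \<open>s\<close> tends to infinity, the behaviour of \<open>mext z\<close> at 0 decides.
\<close>

locale mext_bounded =
  fixes z :: complex and B :: real
  assumes Re_z: "Re z > 0" and bound: "\<And>t. t \<ge> 1 \<Longrightarrow> norm (mext z t) \<le> B"
begin

abbreviation r :: real where "r \<equiv> Re z - 1"

lemma B_nonneg: "B \<ge> 0"
  using bound[of 1] order_trans[OF norm_ge_zero] by fastforce

text \<open>The bound at t = 1 is a bound for the coefficient \<open>mcoeff z\<close>.\<close>

lemma norm_mext_le_powr: "0 < t \<Longrightarrow> t \<le> 1 \<Longrightarrow> norm (mext z t) \<le> B * t powr r"
  using bound[of 1] by (simp add: mext_def norm_mult norm_of_real_powr mult_right_mono)

lemma mext_nonpos [simp]: "t \<le> 0 \<Longrightarrow> mext z t = 0"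
  by (simp add: mext_def)

lemma norm_mext_le:
  assumes "t > 0"
  shows "norm (mext z t) \<le> B * (1 + t powr r)"
proof (cases "t \<le> 1")
  case True
  then show ?thesis using norm_mext_le_powr[OF assms True] B_nonneg by (simp add: distrib_left)
next
  case False
  then show ?thesis using bound[of t] B_nonneg by (simp add: distrib_left add_increasing2)
qed

text \<open>A majorant independent of \<open>n\<close>, for the Laplace transform near 0.\<close>

lemma norm_mext_stretched_le:
  assumes "n \<ge> (1::real)" "x > 0"
  shows "norm (mext z (n * x)) \<le> B * (1 + x powr r)"
proof (cases "n * x \<le> 1")
  case True
  have "norm (mext z (n * x)) \<le> B * (n * x) powr r"
    using assms True by (intro norm_mext_le_powr) auto
  also have "(n * x) powr r \<le> 1 + x powr r"
  proof (cases "r \<ge> 0")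
    case True
    have "(n * x) powr r \<le> 1 powr r" using True \<open>n * x \<le> 1\<close> assms by (intro powr_mono2) auto
    then show ?thesis by (simp add: add_increasing2)
  next
    case False
    have "(n * x) powr r \<le> x powr r" using False assms by (intro powr_mono2') (auto simp: mult_le_cancel_right1)
    then show ?thesis by simp
  qed
  finally show ?thesis using B_nonneg by (simp add: mult_left_mono)
next
  case False
  then show ?thesis using bound[of "n * x"] B_nonneg by (simp add: distrib_left add_increasing2)
qed

text \<open>The counterpart for the transform near infinity. For x \<le> n the powers of n cancel
  exactly; for x > n the power of n alone is at most x^r or 1, according to the sign of r.\<close>

lemma norm_mext_shrunk_le:
  assumes "n \<ge> (1::real)" "x > 0"
  shows "norm (of_real n powr (z - 1) * mext z (x / n)) \<le> B * (1 + x powr r)"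
proof (cases "x \<le> n")
  case True
  have "norm (of_real n powr (z - 1) * mext z (x / n)) \<le> n powr r * (B * (x / n) powr r)"
    unfolding norm_mult using assms True norm_mext_le_powr[of "x / n"]
    by (simp add: norm_of_real_powr mult_left_mono)
  also have "\<dots> = B * x powr r" using assms by (simp add: powr_divide)
  finally show ?thesis using B_nonneg by (simp add: distrib_left)
next
  case False
  have "norm (of_real n powr (z - 1) * mext z (x / n)) \<le> n powr r * B"
    unfolding norm_mult using assms False bound[of "x / n"]
    by (simp add: norm_of_real_powr mult_left_mono)
  also have "n powr r \<le> 1 + x powr r"
  proof (cases "r \<ge> 0")
    case True
    have "n powr r \<le> x powr r" using True False assms by (intro powr_mono2) auto
    then show ?thesis by simp
  next
    case r: False
    have "n powr r \<le> n powr 0" using r assms by (intro powr_mono) auto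
    then show ?thesis using assms by (simp add: add_increasing2)
  qed
  finally show ?thesis using B_nonneg by (simp add: mult_right_mono mult.commute)
qed

lemma mext_measurable [measurable]: "mext z \<in> borel_measurable borel"
proof -
  have "(\<lambda>t. indicator {0<..} t *\<^sub>R mext z t) \<in> borel_measurable borel"
    by (intro borel_measurable_continuous_on_indicator continuous_on_mext Re_z) auto
  also have "(\<lambda>t. indicator {0<..} t *\<^sub>R mext z t) = mext z"
    by (auto simp: fun_eq_iff indicator_def)
  finally show ?thesis .
qed

lemma integrable_weighted_mext:
  fixes w :: "real \<Rightarrow> real"
  assumes "b > 0" and [measurable]: "w \<in> borel_measurable borel"
    and "\<And>t. t > 0 \<Longrightarrow> \<bar>w t\<bar> \<le> C * exp (- (b * t))"
  shows "integrable lborel (\<lambda>t. w t *\<^sub>R mext z t)"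
proof (rule Bochner_Integration.integrable_bound)
  show "integrable lborel (\<lambda>t. C * B * (indicator {0<..} t * (exp (- (b * t)) * (1 + t powr r))))"
    using integrable_exp_powr_dominator[of r b] assms(1) Re_z by simp
  show "AE t in lborel. norm (w t *\<^sub>R mext z t) \<le> norm (C * B * (indicator {0<..} t * (exp (- (b * t)) * (1 + t powr r))))"
  proof (intro AE_I2)
    fix t :: real
    show "norm (w t *\<^sub>R mext z t) \<le> norm (C * B * (indicator {0<..} t * (exp (- (b * t)) * (1 + t powr r))))"
    proof (cases "t > 0")
      case True
      have "\<bar>w t\<bar> * norm (mext z t) \<le> (C * exp (- (b * t))) * (B * (1 + t powr r))"
        using assms(3)[OF True] norm_mext_le[OF True] by (intro mult_mono) auto
      also have "\<dots> \<le> \<bar>(C * exp (- (b * t))) * (B * (1 + t powr r))\<bar>" by simp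
      finally show ?thesis using True by (simp add: mult_ac)
    qed simp
  qed
qed simp

section \<open>The Laplace transform and its differential equation\<close>

definition Lap :: "real \<Rightarrow> complex" where
  "Lap s = (\<integral>t. exp (- (s * t)) *\<^sub>R mext z t \<partial>lborel)"

definition Lap1 :: "real \<Rightarrow> complex" where
  "Lap1 s = (\<integral>t. (t * exp (- (s * t))) *\<^sub>R mext z t \<partial>lborel)"

lemma Lap_integrable: "s > 0 \<Longrightarrow> integrable lborel (\<lambda>t. exp (- (s * t)) *\<^sub>R mext z t)"
  by (rule integrable_weighted_mext[of s _ 1]) auto

lemma Lap1_integrable:
  assumes "s > 0"
  shows "integrable lborel (\<lambda>t. (t * exp (- (s * t))) *\<^sub>R mext z t)"
  by (rule integrable_weighted_mext[of "s / 2" _ "2 / s"])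
     (use assms mult_exp_minus_le[OF assms] in auto)

lemma Lap_has_vector_derivative:
  assumes s: "s > 0"
  shows "(Lap has_vector_derivative - Lap1 s) (at s)"
proof -
  \<comment> \<open>Keeping the parameter above s/2 gives the difference quotients the majorant t
    exp(-s t / 2); removing the factor t then leaves decay s/4 and the constant 4/s.\<close>
  define S where "S = {s / 2<..}"
  define Q where "Q = (\<lambda>v t. ((exp (- (v * t)) - exp (- (s * t))) / (v - s)) *\<^sub>R mext z t)"
  have "((\<lambda>v. norm (Lap v - Lap s - (v - s) *\<^sub>R (- Lap1 s)) / norm (v - s)) \<longlongrightarrow> 0) (at s within S)"
    unfolding tendsto_at_iff_sequentially
  proof (intro allI impI)
    fix X assume X: "\<forall>i. X i \<in> S - {s}" "X \<longlonglongrightarrow> s"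
    have Xpos: "X i > 0" "X i \<ge> s / 2" "X i \<noteq> s" for i using X(1)[rule_format, of i] s by (auto simp: S_def)
    have "(\<lambda>i. \<integral>t. Q (X i) t \<partial>lborel) \<longlonglongrightarrow> (\<integral>t. - ((t * exp (- (s * t))) *\<^sub>R mext z t) \<partial>lborel)"
    proof (rule integral_dominated_convergence)
      show "integrable lborel (\<lambda>t. 4 / s * B * (indicator {0<..} t * (exp (- (s / 4 * t)) * (1 + t powr r))))"
        using integrable_exp_powr_dominator[of r "s / 4"] s Re_z by simp
      show "AE t in lborel. (\<lambda>i. Q (X i) t) \<longlonglongrightarrow> - ((t * exp (- (s * t))) *\<^sub>R mext z t)"
      proof (intro AE_I2)
        fix t :: real
        have "((\<lambda>v. exp (- (v * t))) has_real_derivative - (t * exp (- (s * t)))) (at s)"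
          by (auto intro!: derivative_eq_intros)
        then have "((\<lambda>v. (exp (- (v * t)) - exp (- (s * t))) / (v - s)) \<longlongrightarrow> - (t * exp (- (s * t)))) (at s)"
          by (simp add: has_field_derivative_iff)
        then have "(\<lambda>i. (exp (- (X i * t)) - exp (- (s * t))) / (X i - s)) \<longlonglongrightarrow> - (t * exp (- (s * t)))"
          using X Xpos unfolding tendsto_at_iff_sequentially o_def by blast
        from tendsto_scaleR[OF this tendsto_const[of "mext z t"]]
        show "(\<lambda>i. Q (X i) t) \<longlonglongrightarrow> - ((t * exp (- (s * t))) *\<^sub>R mext z t)"
          by (simp add: Q_def)
      qed
      show "AE t in lborel. norm (Q (X i) t) \<le> 4 / s * B * (indicator {0<..} t * (exp (- (s / 4 * t)) * (1 + t powr r)))" for i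
      proof (intro AE_I2)
        fix t :: real
        show "norm (Q (X i) t) \<le> 4 / s * B * (indicator {0<..} t * (exp (- (s / 4 * t)) * (1 + t powr r)))"
        proof (cases "t > 0")
          case True
          have "\<bar>exp (- (X i * t)) - exp (- (s * t))\<bar> \<le> \<bar>X i - s\<bar> * (t * exp (- (s / 2 * t)))"
            using Xpos s True by (intro abs_exp_diff_le) auto
          then have "\<bar>exp (- (X i * t)) - exp (- (s * t))\<bar> / \<bar>X i - s\<bar> \<le> t * exp (- (s / 2 * t))"
            using Xpos(3)[of i] by (simp add: pos_divide_le_eq mult.commute)
          also have "\<dots> \<le> 4 / s * exp (- (s / 4 * t))"
            using mult_exp_minus_le[of "s / 2" t] s by simp
          finally have "\<bar>exp (- (X i * t)) - exp (- (s * t))\<bar> / \<bar>X i - s\<bar> * norm (mext z t)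
              \<le> 4 / s * exp (- (s / 4 * t)) * (B * (1 + t powr r))"
            using norm_mext_le[OF True] s by (intro mult_mono) auto
          then show ?thesis using True by (simp add: Q_def mult_ac)
        qed (simp add: Q_def)
      qed
    qed (simp_all add: Q_def)
    then have "(\<lambda>i. \<integral>t. Q (X i) t \<partial>lborel) \<longlonglongrightarrow> - Lap1 s"
      by (simp add: Lap1_def)
    moreover have "(\<integral>t. Q (X i) t \<partial>lborel) = (1 / (X i - s)) *\<^sub>R (Lap (X i) - Lap s)" for i
    proof -
      have "(1 / (X i - s)) *\<^sub>R (Lap (X i) - Lap s) =
          (\<integral>t. (1 / (X i - s)) *\<^sub>R (exp (- (X i * t)) *\<^sub>R mext z t - exp (- (s * t)) *\<^sub>R mext z t) \<partial>lborel)"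
        unfolding Lap_def integral_scaleR_right
        by (subst Bochner_Integration.integral_diff) (use Lap_integrable Xpos s in auto)
      also have "\<dots> = (\<integral>t. Q (X i) t \<partial>lborel)"
        by (rule Bochner_Integration.integral_cong) (simp_all add: Q_def scaleR_diff_left[symmetric])
      finally show ?thesis ..
    qed
    ultimately have "(\<lambda>i. norm ((1 / (X i - s)) *\<^sub>R (Lap (X i) - Lap s) - (- Lap1 s))) \<longlonglongrightarrow> norm (- Lap1 s - (- Lap1 s))"
      by (intro tendsto_norm tendsto_diff tendsto_const) simp
    moreover have "norm ((1 / (X i - s)) *\<^sub>R (Lap (X i) - Lap s) - (- Lap1 s))
        = norm (Lap (X i) - Lap s - (X i - s) *\<^sub>R (- Lap1 s)) / norm (X i - s)" for i
    proof -
      have "(1 / (X i - s)) *\<^sub>R (Lap (X i) - Lap s) - (- Lap1 s)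
          = (1 / (X i - s)) *\<^sub>R (Lap (X i) - Lap s - (X i - s) *\<^sub>R (- Lap1 s))"
        using Xpos(3)[of i] by (simp add: scaleR_diff_right scaleR_add_right)
      then show ?thesis by (simp only: norm_scaleR) simp
    qed
    ultimately show "((\<lambda>v. norm (Lap v - Lap s - (v - s) *\<^sub>R (- Lap1 s)) / norm (v - s)) \<circ> X) \<longlonglongrightarrow> 0"
      by (simp add: o_def)
  qed
  then have "(Lap has_vector_derivative - Lap1 s) (at s within S)"
    unfolding has_vector_derivative_def has_derivative_iff_norm
    by (intro conjI bounded_linear_scaleR_left)
  then show ?thesis
    by (subst (asm) has_vector_derivative_within_open) (use s in \<open>auto simp: S_def\<close>)
qed

text \<open>F(t) = t exp(-s t) m(t) vanishes at 0 and at infinity, so its derivative integrates to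
  0. The factor t makes t m' appear, to which the delay equation applies; the delayed term
  transforms into exp(-s) Lap(s). The left-hand side is the derivative of s Lap(s).\<close>

lemma Lap_equation:
  assumes s: "s > 0"
  shows "Lap s - s *\<^sub>R Lap1 s = (z - 1) * of_real (exp (- s) - 1) * Lap s"
proof -
  define F where "F = (\<lambda>t. (t * exp (- (s * t))) *\<^sub>R mext z t)"
  define G where "G = (\<lambda>t. exp (- (s * t)) *\<^sub>R mext z t - s *\<^sub>R ((t * exp (- (s * t))) *\<^sub>R mext z t)
      + (z - 1) * (exp (- (s * t)) *\<^sub>R mext z t) - (z - 1) * (exp (- (s * t)) *\<^sub>R mext z (t - 1)))"
  have shift: "exp (- (s * t)) *\<^sub>R mext z (t - 1) = exp (- s) *\<^sub>R (exp (- (s * (t - 1))) *\<^sub>R mext z (t - 1))" for t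
    by (simp add: exp_add[symmetric] algebra_simps)
  have int_shift: "integrable lborel (\<lambda>t. exp (- (s * t)) *\<^sub>R mext z (t - 1))"
    unfolding shift
    by (rule integrable_scaleR_right) (use lborel_integrable_real_affine[OF Lap_integrable[OF s], of 1 "-1"] in simp)
  have integral_shift: "(\<integral>t. exp (- (s * t)) *\<^sub>R mext z (t - 1) \<partial>lborel) = exp (- s) *\<^sub>R Lap s"
    unfolding shift integral_scaleR_right
    using lborel_integral_real_affine[of 1 "\<lambda>t. exp (- (s * t)) *\<^sub>R mext z t" "-1"] by (simp add: Lap_def)
  note ints = Lap_integrable[OF s] Lap1_integrable[OF s] int_shift
  have G_int: "integrable lborel G"
    unfolding G_def by (intro Bochner_Integration.integrable_diff Bochner_Integration.integrable_add
        integrable_mult_right integrable_scaleR_right ints)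
  have "(\<integral>t. G t \<partial>lborel) = Lap s - s *\<^sub>R Lap1 s + (z - 1) * Lap s - (z - 1) * (exp (- s) *\<^sub>R Lap s)"
    unfolding G_def
    by (simp only: Bochner_Integration.integral_diff Bochner_Integration.integral_add
        Bochner_Integration.integrable_diff Bochner_Integration.integrable_add
        integrable_mult_right integrable_scaleR_right ints
        integral_mult_right_zero integral_scaleR_right integral_shift flip: Lap_def Lap1_def)
  moreover have "(\<integral>t. G t \<partial>lborel) = 0"
  proof -
    have F0: "F 0 = 0" by (simp add: F_def)
    have contF: "continuous_on {0..} F"
      unfolding continuous_on_def
    proof
      fix t :: real assume t: "t \<in> {0..}"
      show "(F \<longlongrightarrow> F t) (at t within {0..})"
      proof (cases "t = 0")
        case False
        have "isCont F t"
          unfolding F_def using isCont_mext[OF Re_z, of t] t False by (intro continuous_intros) auto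
        then show ?thesis unfolding isCont_def by (rule tendsto_within_subset) simp
      next
        case True
        \<comment> \<open>The factor t outweighs the singularity of m: t t^(Re z - 1) = t^(Re z)
          tends to 0.\<close>
        have "(F \<longlongrightarrow> 0) (at 0 within {0..})"
        proof (rule Lim_null_comparison)
          show "\<forall>\<^sub>F t in at 0 within {0..}. norm (F t) \<le> B * (t + t powr Re z)"
            unfolding eventually_at_filter
          proof (intro always_eventually allI impI)
            fix t :: real assume "t \<noteq> 0" "t \<in> {0..}"
            then have t: "t > 0" by simp
            have "norm (F t) = t * exp (- (s * t)) * norm (mext z t)"
              using t by (simp add: F_def)
            also have "\<dots> \<le> (t * 1) * (B * (1 + t powr r))"
              using t s norm_mext_le[OF t] by (intro mult_mono) auto
            also have "\<dots> = B * (t + t powr Re z)"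
              using t by (simp add: powr_diff field_simps)
            finally show "norm (F t) \<le> B * (t + t powr Re z)" .
          qed
          have "continuous_on {0..} (\<lambda>t. B * (t + t powr Re z))"
            using Re_z by (intro continuous_intros continuous_on_powr') auto
          then have "((\<lambda>t. B * (t + t powr Re z)) \<longlongrightarrow> B * (0 + 0 powr Re z)) (at 0 within {0..})"
            unfolding continuous_on_def by (rule bspec) simp
          then show "((\<lambda>t. B * (t + t powr Re z)) \<longlongrightarrow> 0) (at 0 within {0..})" by simp
        qed
        then show ?thesis using True F0 by simp
      qed
    qed
    have derF: "(F has_vector_derivative G t) (at t)" if t: "t > 0" "t \<noteq> 1" for t
    proof -
      have "((\<lambda>t. t * exp (- (s * t))) has_real_derivative exp (- (s * t)) * (1 - s * t)) (at t)"
        by (auto intro!: derivative_eq_intros simp: algebra_simps)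
      from has_vector_derivative_scaleR[OF this mext_has_vector_derivative[OF Re_z t]]
      have "(F has_vector_derivative
          (t * exp (- (s * t))) *\<^sub>R ((z - 1) / of_real t * (mext z t - mext z (t - 1)))
          + (exp (- (s * t)) * (1 - s * t)) *\<^sub>R mext z t) (at t)"
        by (simp only: F_def)
      moreover have "(t * e) *\<^sub>R ((z - 1) / of_real t * (x - y)) + (e * (1 - s * t)) *\<^sub>R x
          = e *\<^sub>R x - s *\<^sub>R ((t * e) *\<^sub>R x) + (z - 1) * (e *\<^sub>R x) - (z - 1) * (e *\<^sub>R y)" for e and x y :: complex
        using t by (simp add: scaleR_conv_of_real field_simps)
      ultimately show ?thesis by (simp add: G_def)
    qed
    have part: "(\<integral>t. indicator {0..real n} t *\<^sub>R G t \<partial>lborel) = F (real n)" for n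
    proof -
      \<comment> \<open>Only at t = 1 is the derivative missing in the interior, and
        \<open>F\<close> is continuous there.\<close>
      have "(G has_integral (F (real n) - F 0)) {0..real n}"
        by (rule fundamental_theorem_of_calculus_interior_strong[of "{1}"])
           (auto intro: derF continuous_on_subset[OF contF])
      moreover have "set_integrable lborel {0..real n} G"
        unfolding set_integrable_def using G_int by (intro integrable_mult_indicator) auto
      ultimately show ?thesis
        using set_borel_integral_eq_integral(2)[of "{0..real n}" G] F0
        by (simp add: set_lebesgue_integral_def integral_unique)
    qed
    have "(\<lambda>n. \<integral>t. indicator {0..real n} t *\<^sub>R G t \<partial>lborel) \<longlonglongrightarrow> (\<integral>t. G t \<partial>lborel)"
    proof (rule integral_dominated_convergence)
      show "integrable lborel (\<lambda>t. norm (G t))" using G_int by (rule integrable_norm)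
      show "AE t in lborel. (\<lambda>n. indicator {0..real n} t *\<^sub>R G t) \<longlonglongrightarrow> G t"
      proof (intro AE_I2 tendsto_eventually)
        fix t :: real
        obtain j where j: "t \<le> real j" using real_arch_simple by blast
        show "\<forall>\<^sub>F n in sequentially. indicator {0..real n} t *\<^sub>R G t = G t"
          using eventually_ge_at_top[of j]
        proof eventually_elim
          case (elim n)
          \<comment> \<open>For negative \<open>t\<close> the indicator changes nothing, because
            \<open>mext\<close> vanishes at t and at t - 1.\<close>
          then show ?case using j by (cases "t \<ge> 0") (auto simp: G_def)
        qed
      qed
      show "AE t in lborel. norm (indicator {0..real n} t *\<^sub>R G t) \<le> norm (G t)" for n
        by (intro AE_I2) (auto simp: indicator_def)
    qed (use G_int in auto)
    then have lim1: "(\<lambda>n. F (real n)) \<longlonglongrightarrow> (\<integral>t. G t \<partial>lborel)"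
      unfolding part .
    have "(\<lambda>n. F (real n)) \<longlonglongrightarrow> 0"
    proof (rule Lim_null_comparison)
      show "\<forall>\<^sub>F n in sequentially. norm (F (real n)) \<le> real n * exp (- s) ^ n * B"
        using eventually_ge_at_top[of 1]
      proof eventually_elim
        case (elim n)
        have "exp (- (s * real n)) = exp (- s) ^ n" by (simp add: exp_of_nat_mult[symmetric] mult.commute)
        then show ?case using elim bound[of "real n"] by (simp add: F_def mult_left_mono)
      qed
      have "(\<lambda>n. real n * exp (- s) ^ n) \<longlonglongrightarrow> 0"
        using powser_times_n_limit_0[of "exp (- s)"] s by simp
      then show "(\<lambda>n. real n * exp (- s) ^ n * B) \<longlonglongrightarrow> 0"
        by (rule tendsto_mult_left_zero)
    qed
    with lim1 show ?thesis by (rule LIMSEQ_unique)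
  qed
  ultimately have "Lap s - s *\<^sub>R Lap1 s + (z - 1) * Lap s - (z - 1) * (exp (- s) *\<^sub>R Lap s) = 0"
    by simp
  moreover have "u = w - v" if "u + v - w = 0" for u v w :: complex
    using that by (simp add: algebra_simps)
  ultimately have "Lap s - s *\<^sub>R Lap1 s = (z - 1) * (exp (- s) *\<^sub>R Lap s) - (z - 1) * Lap s"
    by blast
  also have "\<dots> = (z - 1) * of_real (exp (- s) - 1) * Lap s"
    by (simp add: scaleR_conv_of_real algebra_simps)
  finally show ?thesis .
qed

text \<open>The derivative (1 - exp(-s)) / s of \<open>Ein\<close> is the coefficient of the linear
  equation for s Lap(s), so the exponential is its integrating factor.\<close>

lemma exp_Ein_Lap_const:
  "\<exists>K. \<forall>s>0. exp ((z - 1) * of_real (Ein s)) * (s *\<^sub>R Lap s) = K"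
proof -
  have "((\<lambda>s. exp ((z - 1) * of_real (Ein s)) * (s *\<^sub>R Lap s)) has_vector_derivative 0) (at s within {0<..})"
    if s: "s \<in> {0<..}" for s
  proof -
    have s0: "s > 0" using s by simp
    let ?E = "exp ((z - 1) * of_real (Ein s))"
    have "((\<lambda>s. (z - 1) * of_real (Ein s)) has_vector_derivative (z - 1) * of_real ((1 - exp (- s)) / s)) (at s)"
      by (intro has_vector_derivative_mult_right has_vector_derivative_of_real Ein_has_real_derivative s0)
    from field_vector_diff_chain_within[OF this has_field_derivative_at_within[OF DERIV_exp]]
    have dE: "((\<lambda>s. exp ((z - 1) * of_real (Ein s))) has_vector_derivative
        (z - 1) * of_real ((1 - exp (- s)) / s) * ?E) (at s)"
      by (simp add: o_def)
    have dN: "((\<lambda>s. s *\<^sub>R Lap s) has_vector_derivative (s *\<^sub>R (- Lap1 s) + 1 *\<^sub>R Lap s)) (at s)"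
      by (rule has_vector_derivative_scaleR[OF _ Lap_has_vector_derivative[OF s0]]) (auto intro!: derivative_eq_intros)
    have "((\<lambda>s. exp ((z - 1) * of_real (Ein s)) * (s *\<^sub>R Lap s)) has_vector_derivative
        (?E * (s *\<^sub>R (- Lap1 s) + 1 *\<^sub>R Lap s) + (z - 1) * of_real ((1 - exp (- s)) / s) * ?E * (s *\<^sub>R Lap s))) (at s)"
      by (rule has_vector_derivative_mult[OF dE dN])
    moreover have "s *\<^sub>R (- Lap1 s) + 1 *\<^sub>R Lap s = (z - 1) * of_real (exp (- s) - 1) * Lap s"
      using Lap_equation[OF s0] by simp
    moreover have "?E * ((z - 1) * of_real (exp (- s) - 1) * Lap s)
        + (z - 1) * of_real ((1 - exp (- s)) / s) * ?E * (s *\<^sub>R Lap s) = 0"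
    proof -
      have "(z - 1) * of_real ((1 - exp (- s)) / s) * ?E * (s *\<^sub>R Lap s)
          = (z - 1) * (of_real ((1 - exp (- s)) / s) * of_real s) * ?E * Lap s"
        by (simp only: scaleR_conv_of_real mult_ac)
      also have "of_real ((1 - exp (- s)) / s) * of_real s = - (of_real (exp (- s) - 1) :: complex)"
        unfolding of_real_mult[symmetric] using s0 by simp
      finally show ?thesis by (simp only: mult_minus_left mult_minus_right mult_ac add.right_inverse)
    qed
    ultimately have "((\<lambda>s. exp ((z - 1) * of_real (Ein s)) * (s *\<^sub>R Lap s)) has_vector_derivative 0) (at s)"
      by (simp only:)
    then show ?thesis
      by (rule has_vector_derivative_at_within)
  qed
  from has_vector_derivative_zero_constant[OF convex_real_interval(3) this]
  obtain K where "\<And>s. s \<in> {0<..} \<Longrightarrow> exp ((z - 1) * of_real (Ein s)) * (s *\<^sub>R Lap s) = K"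
    by blast
  then show ?thesis by auto
qed

section \<open>The Laplace transform at both ends\<close>

lemma Lap_rescale:
  assumes "s > 0"
  shows "s *\<^sub>R Lap s = (\<integral>x. exp (- x) *\<^sub>R mext z (x / s) \<partial>lborel)"
proof -
  have "Lap s = \<bar>1 / s\<bar> *\<^sub>R (\<integral>x. exp (- (s * (0 + 1 / s * x))) *\<^sub>R mext z (0 + 1 / s * x) \<partial>lborel)"
    unfolding Lap_def by (rule lborel_integral_real_affine) (use assms in simp)
  then show ?thesis using assms by simp
qed

text \<open>An Abelian limit: after rescaling, m(n x) tends to L for every x > 0, and exp(-x) has
  integral 1. The index \<open>Suc n\<close> keeps the stretching factor at least 1.\<close>

lemma Lap_at_0:
  assumes "(mext z \<longlongrightarrow> L) at_top"
  shows "(\<lambda>n. (1 / real n) *\<^sub>R Lap (1 / real n)) \<longlonglongrightarrow> L"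
proof -
  have "(\<lambda>n. \<integral>x. exp (- x) *\<^sub>R mext z (real (Suc n) * x) \<partial>lborel) \<longlonglongrightarrow>
      (\<integral>x. indicator {0<..} x *\<^sub>R (of_real (exp (- x)) * L) \<partial>lborel)"
  proof (rule integral_dominated_convergence)
    show "integrable lborel (\<lambda>x. B * (indicator {0<..} x * (exp (- (1 * x)) * (1 + x powr r))))"
      using integrable_exp_powr_dominator[of r 1] Re_z by simp
    show "AE x in lborel. (\<lambda>n. exp (- x) *\<^sub>R mext z (real (Suc n) * x)) \<longlonglongrightarrow> indicator {0<..} x *\<^sub>R (of_real (exp (- x)) * L)"
    proof (intro AE_I2)
      fix x :: real
      show "(\<lambda>n. exp (- x) *\<^sub>R mext z (real (Suc n) * x)) \<longlonglongrightarrow> indicator {0<..} x *\<^sub>R (of_real (exp (- x)) * L)"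
      proof (cases "x > 0")
        case True
        have "filterlim (\<lambda>n. real (Suc n) * x) at_top sequentially"
          by (intro filterlim_at_top_mult_tendsto_pos[OF tendsto_const True]
                filterlim_compose[OF filterlim_real_sequentially filterlim_Suc])
        from tendsto_scaleR[OF tendsto_const[of "exp (- x)"] filterlim_compose[OF assms this]]
        show ?thesis using True by (simp add: scaleR_conv_of_real)
      qed (simp add: mult_nonneg_nonpos)
    qed
    show "AE x in lborel. norm (exp (- x) *\<^sub>R mext z (real (Suc n) * x)) \<le> B * (indicator {0<..} x * (exp (- (1 * x)) * (1 + x powr r)))" for n
    proof (intro AE_I2)
      fix x :: real
      show "norm (exp (- x) *\<^sub>R mext z (real (Suc n) * x)) \<le> B * (indicator {0<..} x * (exp (- (1 * x)) * (1 + x powr r)))"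
      proof (cases "x > 0")
        case True
        have "exp (- x) * norm (mext z (real (Suc n) * x)) \<le> exp (- x) * (B * (1 + x powr r))"
          by (intro mult_left_mono norm_mext_stretched_le True) auto
        then show ?thesis using True by (simp add: mult_ac)
      qed (simp add: mult_nonneg_nonpos)
    qed
  qed auto
  moreover have "(\<integral>x. indicator {0<..} x *\<^sub>R (of_real (exp (- x)) * L) \<partial>lborel) = L"
  proof -
    \<comment> \<open>The power with exponent 1 - 1 equals 1 for x > 0; it casts the integral as
      that of \<open>Gamma 1\<close>.\<close>
    have "(\<integral>x. indicator {0<..} x *\<^sub>R (of_real (exp (- x)) * L) \<partial>lborel)
        = (\<integral>x. (indicator {0<..} x *\<^sub>R (of_real (exp (- x)) * of_real x powr (1 - 1))) * L \<partial>lborel)"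
      by (rule Bochner_Integration.integral_cong) (auto simp: indicator_def)
    also have "\<dots> = L"
      using integral_Gamma_lborel[of 1] by (simp only: integral_mult_left_zero) simp
    finally show ?thesis .
  qed
  moreover have "(1 / real (Suc n)) *\<^sub>R Lap (1 / real (Suc n)) = (\<integral>x. exp (- x) *\<^sub>R mext z (real (Suc n) * x) \<partial>lborel)" for n
    by (subst Lap_rescale) (auto simp: mult.commute)
  ultimately have "(\<lambda>n. (1 / real (Suc n)) *\<^sub>R Lap (1 / real (Suc n))) \<longlonglongrightarrow> L"
    by simp
  then show ?thesis by (rule LIMSEQ_imp_Suc)
qed

text \<open>Once n exceeds x, the argument x / n lies where m is the pure power, and n^(z - 1) m(x /
  n) no longer depends on n. What remains integrates to \<open>mcoeff z * Gamma z\<close>.\<close>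

lemma Lap_at_infinity:
  "(\<lambda>n. of_real (real n) powr (z - 1) * (real n *\<^sub>R Lap (real n))) \<longlonglongrightarrow> g1 z"
proof -
  have "(\<lambda>n. \<integral>x. exp (- x) *\<^sub>R (of_real (real (Suc n)) powr (z - 1) * mext z (x / real (Suc n))) \<partial>lborel) \<longlonglongrightarrow>
      (\<integral>x. mcoeff z * (indicator {0<..} x *\<^sub>R (of_real (exp (- x)) * of_real x powr (z - 1))) \<partial>lborel)"
  proof (rule integral_dominated_convergence)
    show "integrable lborel (\<lambda>x. B * (indicator {0<..} x * (exp (- (1 * x)) * (1 + x powr r))))"
      using integrable_exp_powr_dominator[of r 1] Re_z by simp
    show "AE x in lborel. (\<lambda>n. exp (- x) *\<^sub>R (of_real (real (Suc n)) powr (z - 1) * mext z (x / real (Suc n)))) \<longlonglongrightarrow>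
        mcoeff z * (indicator {0<..} x *\<^sub>R (of_real (exp (- x)) * of_real x powr (z - 1)))"
    proof (intro AE_I2 tendsto_eventually)
      fix x :: real
      obtain j where j: "x \<le> real j" using real_arch_simple by blast
      show "\<forall>\<^sub>F n in sequentially. exp (- x) *\<^sub>R (of_real (real (Suc n)) powr (z - 1) * mext z (x / real (Suc n))) =
          mcoeff z * (indicator {0<..} x *\<^sub>R (of_real (exp (- x)) * of_real x powr (z - 1)))"
        using eventually_ge_at_top[of j]
      proof eventually_elim
        case (elim n)
        show ?case
        proof (cases "x > 0")
          case True
          define N where "N = real (Suc n)"
          have N: "N > 0" "x \<le> N" using elim j by (auto simp: N_def)
          then have xN: "x / N > 0" "x / N \<le> 1" using True by simp_all
          have "of_real (x / N) powr (z - 1) = of_real x powr (z - 1) / of_real N powr (z - 1)"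
            using N True by (simp add: powr_def Ln_of_real ln_div exp_diff[symmetric] algebra_simps del: of_real_divide)
          then have "of_real N powr (z - 1) * mext z (x / N) = mcoeff z * of_real x powr (z - 1)"
            using N xN unfolding mext_def by (simp del: of_real_divide)
          then show ?thesis using True unfolding N_def[symmetric] by (simp add: scaleR_conv_of_real)
        qed (simp add: divide_nonpos_pos)
      qed
    qed
    show "AE x in lborel. norm (exp (- x) *\<^sub>R (of_real (real (Suc n)) powr (z - 1) * mext z (x / real (Suc n))))
        \<le> B * (indicator {0<..} x * (exp (- (1 * x)) * (1 + x powr r)))" for n
    proof (intro AE_I2)
      fix x :: real
      show "norm (exp (- x) *\<^sub>R (of_real (real (Suc n)) powr (z - 1) * mext z (x / real (Suc n))))
          \<le> B * (indicator {0<..} x * (exp (- (1 * x)) * (1 + x powr r)))"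
      proof (cases "x > 0")
        case True
        have "exp (- x) * norm (of_real (real (Suc n)) powr (z - 1) * mext z (x / real (Suc n))) \<le> exp (- x) * (B * (1 + x powr r))"
          by (intro mult_left_mono norm_mext_shrunk_le True) auto
        then show ?thesis using True by (simp add: mult_ac)
      qed (simp add: divide_nonpos_pos)
    qed
  qed (auto intro!: borel_measurable_times borel_measurable_scaleR)
  moreover have "(\<integral>x. mcoeff z * (indicator {0<..} x *\<^sub>R (of_real (exp (- x)) * of_real x powr (z - 1))) \<partial>lborel) = g1 z"
  proof -
    have "Gamma z \<noteq> 0" using Re_z by (auto simp: Gamma_eq_zero_iff elim!: nonpos_Ints_cases)
    then show ?thesis
      unfolding integral_mult_right_zero integral_Gamma_lborel[OF Re_z] by (simp add: mcoeff_def)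
  qed
  moreover have "of_real (real (Suc n)) powr (z - 1) * (real (Suc n) *\<^sub>R Lap (real (Suc n)))
      = (\<integral>x. exp (- x) *\<^sub>R (of_real (real (Suc n)) powr (z - 1) * mext z (x / real (Suc n))) \<partial>lborel)" for n
    by (subst Lap_rescale) (simp_all flip: integral_mult_right_zero)
  ultimately have "(\<lambda>n. of_real (real (Suc n)) powr (z - 1) * (real (Suc n) *\<^sub>R Lap (real (Suc n)))) \<longlonglongrightarrow> g1 z"
    by simp
  then show ?thesis by (rule LIMSEQ_imp_Suc)
qed

text \<open>The constant is evaluated at both ends: at s = 1/n it tends to \<open>L\<close>; at s =
  n, splitting off n^(z - 1) = exp((z - 1) ln n) leaves \<open>Ein n - ln n\<close> in the
  exponent.\<close>

lemma mext_limit_eq_ell: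
  assumes "(mext z \<longlongrightarrow> L) at_top"
  shows "L = ell z"
proof -
  obtain K where K: "\<And>s. s > 0 \<Longrightarrow> exp ((z - 1) * of_real (Ein s)) * (s *\<^sub>R Lap s) = K"
    using exp_Ein_Lap_const by blast
  have pos: "\<forall>\<^sub>F n in sequentially. real n > 0"
    using eventually_gt_at_top[of 0] by eventually_elim simp
  have "(\<lambda>n. exp ((z - 1) * of_real (Ein (1 / real n))) * ((1 / real n) *\<^sub>R Lap (1 / real n)))
      \<longlonglongrightarrow> exp ((z - 1) * of_real 0) * L"
    by (intro tendsto_intros Lap_at_0[OF assms] Ein_inverse_LIMSEQ)
  moreover have "\<forall>\<^sub>F n in sequentially. exp ((z - 1) * of_real (Ein (1 / real n))) * ((1 / real n) *\<^sub>R Lap (1 / real n)) = K"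
    using pos by eventually_elim (rule K, simp)
  ultimately have 1: "K = L"
    using tendsto_unique[OF _ tendsto_eventually] by force
  have "(\<lambda>n. exp ((z - 1) * of_real (Ein (real n) - ln (real n))) *
      (of_real (real n) powr (z - 1) * (real n *\<^sub>R Lap (real n)))) \<longlonglongrightarrow> exp ((z - 1) * of_real euler_mascheroni) * g1 z"
    by (intro tendsto_intros Lap_at_infinity Ein_minus_ln_LIMSEQ)
  moreover have "\<forall>\<^sub>F n in sequentially. exp ((z - 1) * of_real (Ein (real n) - ln (real n))) *
      (of_real (real n) powr (z - 1) * (real n *\<^sub>R Lap (real n))) = K"
    using pos
  proof eventually_elim
    case (elim n)
    have "exp ((z - 1) * of_real (Ein (real n) - ln (real n))) * of_real (real n) powr (z - 1) = exp ((z - 1) * of_real (Ein (real n)))"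
      using elim by (simp add: powr_def Ln_of_real exp_add[symmetric] algebra_simps del: of_real_of_nat_eq)
    then show ?case using K[OF elim] by (simp add: mult.assoc[symmetric])
  qed
  ultimately have "K = exp ((z - 1) * of_real euler_mascheroni) * g1 z"
    using tendsto_unique[OF _ tendsto_eventually] by force
  then show ?thesis using 1 by (simp add: ell_eq_g1)
qed

end

lemma exp_decay_at_top: "((\<lambda>\<alpha>::real. exp (- \<alpha> * ln \<alpha> + C * \<alpha>)) \<longlongrightarrow> 0) at_top"
proof -
  have "filterlim (\<lambda>\<alpha>::real. \<alpha> * (ln \<alpha> - C)) at_top at_top"
    by (intro filterlim_at_top_mult_at_top filterlim_ident filterlim_at_top_add_at_top)
       (use filterlim_tendsto_add_at_top[OF tendsto_const[of "- C"] ln_at_top] in simp)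
  then have "filterlim (\<lambda>\<alpha>::real. - (\<alpha> * (ln \<alpha> - C))) at_bot at_top"
    by (simp add: filterlim_uminus_at_bot)
  from filterlim_compose[OF exp_at_bot this] show ?thesis
    by (simp add: algebra_simps)
qed

text \<open>For fixed \<open>z\<close>, compactness of [1, T] and convergence beyond T provide the
  bound that the Laplace argument needs; nothing here has to be uniform in \<open>z\<close>.\<close>

lemma mfun_limit_ell:
  assumes "Re z > 0" and lim: "\<And>\<alpha>. \<alpha> \<ge> \<alpha>0 \<Longrightarrow> norm (mext z \<alpha> - L) \<le> exp (- \<alpha> * ln \<alpha> + C * \<alpha>)"
  shows "L = ell z"
proof -
  have "((\<lambda>\<alpha>. mext z \<alpha> - L) \<longlongrightarrow> 0) at_top"
  proof (rule Lim_null_comparison[OF _ exp_decay_at_top])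
    show "\<forall>\<^sub>F \<alpha> in at_top. norm (mext z \<alpha> - L) \<le> exp (- \<alpha> * ln \<alpha> + C * \<alpha>)"
      using eventually_ge_at_top[of \<alpha>0] by eventually_elim (rule lim)
  qed
  then have L: "(mext z \<longlongrightarrow> L) at_top" by (simp add: Lim_null[symmetric] LIM_zero_iff)
  from order_tendstoD(2)[OF tendsto_norm[OF L], of "norm L + 1"]
  have "\<forall>\<^sub>F \<alpha> in at_top. norm (mext z \<alpha>) < norm L + 1" by simp
  then obtain T where T: "\<And>t. t \<ge> T \<Longrightarrow> norm (mext z t) < norm L + 1"
    by (auto simp: eventually_at_top_linorder)
  have "compact (mext z ` {1..T})"
    by (intro compact_continuous_image continuous_on_subset[OF continuous_on_mext[OF assms(1)]]) auto
  then obtain D where D: "\<And>t. t \<in> {1..T} \<Longrightarrow> norm (mext z t) \<le> D"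
    using compact_imp_bounded[THEN bounded_iff[THEN iffD1]] by (metis imageI)
  interpret mext_bounded z "max D (norm L + 1)"
  proof
    show "norm (mext z t) \<le> max D (norm L + 1)" if "t \<ge> 1" for t
      using D[of t] T[of t] that by (cases "t \<le> T") auto
  qed fact
  show ?thesis by (rule mext_limit_eq_ell[OF L])
qed

theorem theorem7:
  "(\<exists>K>0. \<forall>R>0. \<exists>C \<alpha>0. \<forall>z::complex. Re z > 0 \<and> norm z \<le> R \<longrightarrow>
      (\<forall>\<alpha>\<ge>\<alpha>0. norm (mfun z \<alpha> - ell z) \<le> (K::real) * exp (- \<alpha> * ln \<alpha> + C * \<alpha>)))
   \<and> (\<forall>z. convergent_prod (ell_factor z))
   \<and> ell analytic_on UNIV
   \<and> (\<forall>z. z \<noteq> 1 \<and> (\<forall>p::nat. prime p \<longrightarrow> z \<noteq> 1 - of_nat p) \<longrightarrow> ell z \<noteq> 0)"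
proof (intro conjI)
  show "\<exists>K>0. \<forall>R>0. \<exists>C \<alpha>0. \<forall>z::complex. Re z > 0 \<and> norm z \<le> R \<longrightarrow>
      (\<forall>\<alpha>\<ge>\<alpha>0. norm (mfun z \<alpha> - ell z) \<le> (K::real) * exp (- \<alpha> * ln \<alpha> + C * \<alpha>))"
  \<comment> \<open>K = 1 suffices, the constant having been absorbed into \<open>C\<close>.\<close>
  proof (rule exI[of _ 1], intro conjI allI impI)
    fix R :: real assume "R > 0"
    then obtain C \<alpha>0 where "\<alpha>0 \<ge> 1"
      and ex: "\<And>z. Re z > 0 \<Longrightarrow> norm z \<le> R \<Longrightarrow>
        \<exists>L. \<forall>\<alpha>\<ge>\<alpha>0. norm (mext z \<alpha> - L) \<le> exp (- \<alpha> * ln \<alpha> + C * \<alpha>)"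
      using mfun_limit_rate by metis
    have "norm (mfun z \<alpha> - ell z) \<le> 1 * exp (- \<alpha> * ln \<alpha> + C * \<alpha>)"
      if z: "Re z > 0" "norm z \<le> R" and \<alpha>: "\<alpha> \<ge> \<alpha>0" for z \<alpha>
    proof -
      obtain L where L: "\<And>\<alpha>. \<alpha> \<ge> \<alpha>0 \<Longrightarrow> norm (mext z \<alpha> - L) \<le> exp (- \<alpha> * ln \<alpha> + C * \<alpha>)"
        using ex[OF z] by blast
      then have "L = ell z" by (rule mfun_limit_ell[OF z(1)])
      then show ?thesis
        using L[OF \<alpha>] \<alpha> \<open>\<alpha>0 \<ge> 1\<close> mext_eq_mfun[OF z(1), of \<alpha>] by simp
    qed
    then show "\<exists>C \<alpha>0. \<forall>z::complex. Re z > 0 \<and> norm z \<le> R \<longrightarrow>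
        (\<forall>\<alpha>\<ge>\<alpha>0. norm (mfun z \<alpha> - ell z) \<le> 1 * exp (- \<alpha> * ln \<alpha> + C * \<alpha>))" by blast
  qed simp
  show "\<forall>z. convergent_prod (ell_factor z)"
    using convergent_prod_ell_factor by simp
  show "ell analytic_on UNIV"
    by (rule ell_analytic)
  show "\<forall>z. z \<noteq> 1 \<and> (\<forall>p::nat. prime p \<longrightarrow> z \<noteq> 1 - of_nat p) \<longrightarrow> ell z \<noteq> 0"
    using ell_nonzero by simp
qed

end
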